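(* Let $f: A \to B$ be a flat, finitely presented epimorphism of semirings. Then $f$ induces an isomorphism of $\mathrm{Spec}(B)$ onto a quasi-compact open subset of $\mathrm{Spec}(A)$ in the Zariski topology.
   Context: Semirings are commutative with $0$ and $1$. For a semiring $A$, $A\text{-mod}$ is the category of $A$-modules (commutative monoids with an $A$-action) with tensor product $\otimes_A$; an $A$-module $M$ is flat if $-\otimes_A M$ preserves finite limits. A semiring map $A\to B$ is flat if $B$ is a flat $A$-module; it is finitely presented if $B$ is a coequaliser of two $A$-algebra homomorphisms $A[y_1,\dots,y_r]\rightrightarrows A[x_1,\dots,x_d]$ (equivalently, $\mathrm{Hom}_{A\text{-alg}}(B,-)$ commutes with filtered colimits); it is an epimorphism if it is an epimorphism in the category of semirings. An ideal of a semiring $R$ is an $R$-submodule; an ideal $\mathfrak{p}\subset R$ is prime if $R\setminus\mathfrak{p}$ is a multiplicatively closed subset (containing $1$). $\mathrm{Spec}(R)$ is the topological space of prime ideals of $R$ with the Zariski topology, generated by the sets $D(a)=\{\mathfrak{p} : a\notin\mathfrak{p}\}$ (equivalently, the image of $\mathrm{Spec}(R[1/a])$) for $a\in R$; thus isomorphisms are homeomorphisms. A map $f:A\to B$ induces $\mathrm{Spec}(B)\to\mathrm{Spec}(A)$, $\mathfrak{q}\mapsto f^{-1}(\mathfrak{q})$. *)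

theory Defs
  imports
    "HOL-Algebra.Module"
    "HOL-Library.Multiset"
    "HOL-Library.Infinite_Typeclass"
    "HOL-Analysis.Function_Topology"
begin

text \<open>
  Size convention: notions that quantify over all semirings, algebras or modules refer to the
  structures whose carrier is a subset of one infinite type \<open>'u\<close>, which plays the role of a
  universe. Since \<open>'u\<close> is infinite, every finite limit, tensor product, quotient and finitely
  presented algebra formed from such structures is isomorphic to one carried by \<open>'u\<close>.
  Maps are only considered on carriers, so two morphisms are identified when they agree there.
\<close>


section \<open>Commutative semirings and modules over them\<close>

locale csemiring = semiring R + comm_monoid R for R (structure)

text \<open>Unlike for rings, preservation of zero has to be required separately.\<close>

definition csemiring_hom ::
  "('a, 'm) ring_scheme \<Rightarrow> ('b, 'n) ring_scheme \<Rightarrow> ('a \<Rightarrow> 'b) set" where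
  "csemiring_hom R S = {h \<in> ring_hom R S. h \<zero>\<^bsub>R\<^esub> = \<zero>\<^bsub>S\<^esub>}"

text \<open>As for the library's modules, the multiplicative fields of the record are irrelevant.\<close>

locale semimodule = R?: csemiring R + M?: abelian_monoid M
  for R (structure) and M (structure) +
  assumes smult_closed [simp, intro]:
      "\<lbrakk>a \<in> carrier R; x \<in> carrier M\<rbrakk> \<Longrightarrow> a \<odot>\<^bsub>M\<^esub> x \<in> carrier M"
    and smult_l_distr:
      "\<lbrakk>a \<in> carrier R; b \<in> carrier R; x \<in> carrier M\<rbrakk> \<Longrightarrow>
        (a \<oplus>\<^bsub>R\<^esub> b) \<odot>\<^bsub>M\<^esub> x = a \<odot>\<^bsub>M\<^esub> x \<oplus>\<^bsub>M\<^esub> b \<odot>\<^bsub>M\<^esub> x"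
    and smult_r_distr:
      "\<lbrakk>a \<in> carrier R; x \<in> carrier M; y \<in> carrier M\<rbrakk> \<Longrightarrow>
        a \<odot>\<^bsub>M\<^esub> (x \<oplus>\<^bsub>M\<^esub> y) = a \<odot>\<^bsub>M\<^esub> x \<oplus>\<^bsub>M\<^esub> a \<odot>\<^bsub>M\<^esub> y"
    and smult_assoc:
      "\<lbrakk>a \<in> carrier R; b \<in> carrier R; x \<in> carrier M\<rbrakk> \<Longrightarrow>
        (a \<otimes>\<^bsub>R\<^esub> b) \<odot>\<^bsub>M\<^esub> x = a \<odot>\<^bsub>M\<^esub> (b \<odot>\<^bsub>M\<^esub> x)"
    and smult_one [simp]: "x \<in> carrier M \<Longrightarrow> \<one>\<^bsub>R\<^esub> \<odot>\<^bsub>M\<^esub> x = x"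
    and smult_l_null [simp]: "x \<in> carrier M \<Longrightarrow> \<zero>\<^bsub>R\<^esub> \<odot>\<^bsub>M\<^esub> x = \<zero>\<^bsub>M\<^esub>"
    and smult_r_null [simp]: "a \<in> carrier R \<Longrightarrow> a \<odot>\<^bsub>M\<^esub> \<zero>\<^bsub>M\<^esub> = \<zero>\<^bsub>M\<^esub>"

definition semimodule_hom ::
  "'a ring \<Rightarrow> ('a, 'b) module \<Rightarrow> ('a, 'c) module \<Rightarrow> ('b \<Rightarrow> 'c) set" where
  "semimodule_hom A M N = {h \<in> carrier M \<rightarrow> carrier N.
     h \<zero>\<^bsub>M\<^esub> = \<zero>\<^bsub>N\<^esub> \<and>
     (\<forall>x\<in>carrier M. \<forall>y\<in>carrier M. h (x \<oplus>\<^bsub>M\<^esub> y) = h x \<oplus>\<^bsub>N\<^esub> h y) \<and>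
     (\<forall>a\<in>carrier A. \<forall>x\<in>carrier M. h (a \<odot>\<^bsub>M\<^esub> x) = a \<odot>\<^bsub>N\<^esub> h x)}"

definition module_via :: "('a \<Rightarrow> 'b) \<Rightarrow> 'b ring \<Rightarrow> ('a, 'b) module" where
  "module_via f B = \<lparr>carrier = carrier B, monoid.mult = monoid.mult B, one = one B,
     zero = ring.zero B, add = ring.add B, smult = (\<lambda>a b. f a \<otimes>\<^bsub>B\<^esub> b)\<rparr>"


section \<open>Tensor products\<close>

text \<open>
  The tensor product of \<open>M\<close> and \<open>N\<close> is the quotient of the free commutative monoid on
  \<open>carrier M \<times> carrier N\<close>, whose elements are multisets of pairs (formal sums of pure tensors),
  by the congruence generated by the bilinearity relations.
\<close>

inductive tensor_cong ::
  "'a ring \<Rightarrow> ('a, 'b) module \<Rightarrow> ('a, 'c) module \<Rightarrow>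
     ('b \<times> 'c) multiset \<Rightarrow> ('b \<times> 'c) multiset \<Rightarrow> bool"
  for A M N where
  refl: "set_mset s \<subseteq> carrier M \<times> carrier N \<Longrightarrow> tensor_cong A M N s s"
| sym: "tensor_cong A M N s t \<Longrightarrow> tensor_cong A M N t s"
| trans: "\<lbrakk>tensor_cong A M N s t; tensor_cong A M N t u\<rbrakk> \<Longrightarrow> tensor_cong A M N s u"
| plus: "\<lbrakk>tensor_cong A M N s t; tensor_cong A M N s' t'\<rbrakk> \<Longrightarrow>
    tensor_cong A M N (s + s') (t + t')"
| add_left: "\<lbrakk>x \<in> carrier M; x' \<in> carrier M; y \<in> carrier N\<rbrakk> \<Longrightarrow>
    tensor_cong A M N {#(x \<oplus>\<^bsub>M\<^esub> x', y)#} {#(x, y), (x', y)#}"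
| add_right: "\<lbrakk>x \<in> carrier M; y \<in> carrier N; y' \<in> carrier N\<rbrakk> \<Longrightarrow>
    tensor_cong A M N {#(x, y \<oplus>\<^bsub>N\<^esub> y')#} {#(x, y), (x, y')#}"
| zero_left: "y \<in> carrier N \<Longrightarrow> tensor_cong A M N {#(\<zero>\<^bsub>M\<^esub>, y)#} {#}"
| zero_right: "x \<in> carrier M \<Longrightarrow> tensor_cong A M N {#(x, \<zero>\<^bsub>N\<^esub>)#} {#}"
| smult: "\<lbrakk>a \<in> carrier A; x \<in> carrier M; y \<in> carrier N\<rbrakk> \<Longrightarrow>
    tensor_cong A M N {#(a \<odot>\<^bsub>M\<^esub> x, y)#} {#(x, a \<odot>\<^bsub>N\<^esub> y)#}"

definition tensor_class ::
  "'a ring \<Rightarrow> ('a, 'b) module \<Rightarrow> ('a, 'c) module \<Rightarrow>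
     ('b \<times> 'c) multiset \<Rightarrow> ('b \<times> 'c) multiset set" where
  "tensor_class A M N s = {t. tensor_cong A M N s t}"

text \<open>
  The operations are induced from representatives; each union ranges over equal classes.
\<close>

definition tensor ::
  "'a ring \<Rightarrow> ('a, 'b) module \<Rightarrow> ('a, 'c) module \<Rightarrow> ('a, ('b \<times> 'c) multiset set) module" where
  "tensor A M N = \<lparr>
     carrier = tensor_class A M N ` {s. set_mset s \<subseteq> carrier M \<times> carrier N},
     monoid.mult = undefined, one = undefined,
     zero = tensor_class A M N {#},
     add = (\<lambda>S T. \<Union>s\<in>S. \<Union>t\<in>T. tensor_class A M N (s + t)),
     smult = (\<lambda>a S. \<Union>s\<in>S. tensor_class A M N (image_mset (\<lambda>(x, y). (a \<odot>\<^bsub>M\<^esub> x, y)) s))\<rparr>"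

text \<open>The map \<open>h \<otimes> N : M \<otimes> N \<rightarrow> M' \<otimes> N\<close> induced by \<open>h : M \<rightarrow> M'\<close>; its value does not
  depend on the source \<open>M\<close>, which is therefore not an argument.\<close>

definition tensor_map ::
  "'a ring \<Rightarrow> ('a, 'b') module \<Rightarrow> ('a, 'c) module \<Rightarrow> ('b \<Rightarrow> 'b') \<Rightarrow>
     ('b \<times> 'c) multiset set \<Rightarrow> ('b' \<times> 'c) multiset set" where
  "tensor_map A M' N h S = (\<Union>s\<in>S. tensor_class A M' N (image_mset (map_prod h id) s))"


section \<open>Finite limits and flatness\<close>

text \<open>
  Every finite category is isomorphic to one whose objects and arrows are natural numbers;
  \<open>arr_comp J e' e\<close> is the composite of \<open>e\<close> followed by \<open>e'\<close>.
\<close>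

record small_category =
  objs :: "nat set"
  arrs :: "nat set"
  src :: "nat \<Rightarrow> nat"
  tgt :: "nat \<Rightarrow> nat"
  ident :: "nat \<Rightarrow> nat"
  arr_comp :: "nat \<Rightarrow> nat \<Rightarrow> nat"

locale finite_category =
  fixes J :: small_category
  assumes finite_objs: "finite (objs J)"
    and finite_arrs: "finite (arrs J)"
    and src_closed: "e \<in> arrs J \<Longrightarrow> src J e \<in> objs J"
    and tgt_closed: "e \<in> arrs J \<Longrightarrow> tgt J e \<in> objs J"
    and ident_arr: "j \<in> objs J \<Longrightarrow>
      ident J j \<in> arrs J \<and> src J (ident J j) = j \<and> tgt J (ident J j) = j"
    and comp_arr: "\<lbrakk>e \<in> arrs J; e' \<in> arrs J; tgt J e = src J e'\<rbrakk> \<Longrightarrow>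
      arr_comp J e' e \<in> arrs J \<and> src J (arr_comp J e' e) = src J e \<and> tgt J (arr_comp J e' e) = tgt J e'"
    and comp_ident_right: "e \<in> arrs J \<Longrightarrow> arr_comp J e (ident J (src J e)) = e"
    and comp_ident_left: "e \<in> arrs J \<Longrightarrow> arr_comp J (ident J (tgt J e)) e = e"
    and comp_assoc:
      "\<lbrakk>e \<in> arrs J; e' \<in> arrs J; e'' \<in> arrs J; tgt J e = src J e'; tgt J e' = src J e''\<rbrakk> \<Longrightarrow>
        arr_comp J e'' (arr_comp J e' e) = arr_comp J (arr_comp J e'' e') e"

definition module_diagram ::
  "'a ring \<Rightarrow> small_category \<Rightarrow> (nat \<Rightarrow> ('a, 'm) module) \<Rightarrow> (nat \<Rightarrow> 'm \<Rightarrow> 'm) \<Rightarrow> bool" where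
  "module_diagram A J F \<phi> \<longleftrightarrow>
     (\<forall>j\<in>objs J. semimodule A (F j)) \<and>
     (\<forall>e\<in>arrs J. \<phi> e \<in> semimodule_hom A (F (src J e)) (F (tgt J e))) \<and>
     (\<forall>j\<in>objs J. \<forall>x\<in>carrier (F j). \<phi> (ident J j) x = x) \<and>
     (\<forall>e\<in>arrs J. \<forall>e'\<in>arrs J. tgt J e = src J e' \<longrightarrow>
        (\<forall>x\<in>carrier (F (src J e)). \<phi> (arr_comp J e' e) x = \<phi> e' (\<phi> e x)))"

definition module_cone ::
  "'a ring \<Rightarrow> small_category \<Rightarrow> (nat \<Rightarrow> ('a, 'm) module) \<Rightarrow> (nat \<Rightarrow> 'm \<Rightarrow> 'm) \<Rightarrow>
     ('a, 'm) module \<Rightarrow> (nat \<Rightarrow> 'm \<Rightarrow> 'm) \<Rightarrow> bool" where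
  "module_cone A J F \<phi> L p \<longleftrightarrow>
     semimodule A L \<and>
     (\<forall>j\<in>objs J. p j \<in> semimodule_hom A L (F j)) \<and>
     (\<forall>e\<in>arrs J. \<forall>x\<in>carrier L. \<phi> e (p (src J e) x) = p (tgt J e) x)"

definition module_limit_cone ::
  "'a ring \<Rightarrow> small_category \<Rightarrow> (nat \<Rightarrow> ('a, 'm) module) \<Rightarrow> (nat \<Rightarrow> 'm \<Rightarrow> 'm) \<Rightarrow>
     ('a, 'm) module \<Rightarrow> (nat \<Rightarrow> 'm \<Rightarrow> 'm) \<Rightarrow> bool" where
  "module_limit_cone A J F \<phi> L p \<longleftrightarrow>
     module_cone A J F \<phi> L p \<and>
     (\<forall>Q q. module_cone A J F \<phi> Q q \<longrightarrow>
       (\<exists>u\<in>semimodule_hom A Q L.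
          (\<forall>j\<in>objs J. \<forall>x\<in>carrier Q. p j (u x) = q j x) \<and>
          (\<forall>v\<in>semimodule_hom A Q L.
             (\<forall>j\<in>objs J. \<forall>x\<in>carrier Q. p j (v x) = q j x) \<longrightarrow>
             (\<forall>x\<in>carrier Q. v x = u x))))"

definition flat_module :: "('u::infinite) ring \<Rightarrow> ('u, 'u) module \<Rightarrow> bool" where
  "flat_module A M \<longleftrightarrow>
     semimodule A M \<and>
     (\<forall>J (F :: nat \<Rightarrow> ('u, 'u) module) \<phi> L p.
        finite_category J \<longrightarrow> module_diagram A J F \<phi> \<longrightarrow> module_limit_cone A J F \<phi> L p \<longrightarrow>
        module_limit_cone A J
          (\<lambda>j. tensor A (F j) M) (\<lambda>e. tensor_map A (F (tgt J e)) M (\<phi> e))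
          (tensor A L M) (\<lambda>j. tensor_map A (F j) M (p j)))"

definition flat_hom :: "('u::infinite) ring \<Rightarrow> 'u ring \<Rightarrow> ('u \<Rightarrow> 'u) \<Rightarrow> bool" where
  "flat_hom A B f \<longleftrightarrow> f \<in> csemiring_hom A B \<and> flat_module A (module_via f B)"


section \<open>Epimorphisms and finite presentation\<close>

definition csemiring_epi :: "('u::infinite) ring \<Rightarrow> 'u ring \<Rightarrow> ('u \<Rightarrow> 'u) \<Rightarrow> bool" where
  "csemiring_epi A B f \<longleftrightarrow>
     f \<in> csemiring_hom A B \<and>
     (\<forall>(C :: 'u ring) g h.
        csemiring C \<longrightarrow> g \<in> csemiring_hom B C \<longrightarrow> h \<in> csemiring_hom B C \<longrightarrow>
        (\<forall>a\<in>carrier A. g (f a) = h (f a)) \<longrightarrow> (\<forall>b\<in>carrier B. g b = h b))"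

text \<open>
  The polynomial semiring over \<open>A\<close> in the variables numbered \<open>0, \<dots>, d - 1\<close>: a monomial is the
  multiset of its variables, and a polynomial maps monomials to coefficients.
\<close>

definition poly_semiring :: "'a ring \<Rightarrow> nat \<Rightarrow> (nat multiset \<Rightarrow> 'a) ring" where
  "poly_semiring A d = \<lparr>
     carrier = {p. (\<forall>m. p m \<in> carrier A) \<and> finite {m. p m \<noteq> \<zero>\<^bsub>A\<^esub>} \<and>
                   (\<forall>m. \<not> set_mset m \<subseteq> {..<d} \<longrightarrow> p m = \<zero>\<^bsub>A\<^esub>)},
     monoid.mult = (\<lambda>p q m. \<Oplus>\<^bsub>A\<^esub>u\<in>{u. u \<subseteq># m}. p u \<otimes>\<^bsub>A\<^esub> q (m - u)),
     one = (\<lambda>m. if m = {#} then \<one>\<^bsub>A\<^esub> else \<zero>\<^bsub>A\<^esub>),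
     zero = (\<lambda>m. \<zero>\<^bsub>A\<^esub>),
     add = (\<lambda>p q m. p m \<oplus>\<^bsub>A\<^esub> q m)\<rparr>"

definition poly_const :: "'a ring \<Rightarrow> 'a \<Rightarrow> nat multiset \<Rightarrow> 'a" where
  "poly_const A a = (\<lambda>m. if m = {#} then a else \<zero>\<^bsub>A\<^esub>)"

text \<open>An \<open>A\<close>-algebra is a semiring \<open>R\<close> together with its structure map \<open>i : A \<rightarrow> R\<close>.\<close>

definition alg_hom ::
  "'a ring \<Rightarrow> 'b ring \<Rightarrow> ('a \<Rightarrow> 'b) \<Rightarrow> 'c ring \<Rightarrow> ('a \<Rightarrow> 'c) \<Rightarrow> ('b \<Rightarrow> 'c) set" where
  "alg_hom A R i S k = {h \<in> csemiring_hom R S. \<forall>a\<in>carrier A. h (i a) = k a}"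

text \<open>\<open>\<pi> : Q \<rightarrow> B\<close> is a coequaliser of \<open>g, h : P \<rightarrow> Q\<close> in the category of \<open>A\<close>-algebras, where
  \<open>Q\<close> and \<open>B\<close> have the structure maps \<open>i\<close> and \<open>f\<close>.\<close>

definition alg_coequaliser ::
  "('u::infinite) ring \<Rightarrow> 'p ring \<Rightarrow> 'q ring \<Rightarrow> ('u \<Rightarrow> 'q) \<Rightarrow> ('p \<Rightarrow> 'q) \<Rightarrow> ('p \<Rightarrow> 'q) \<Rightarrow>
     'u ring \<Rightarrow> ('u \<Rightarrow> 'u) \<Rightarrow> ('q \<Rightarrow> 'u) \<Rightarrow> bool" where
  "alg_coequaliser A P Q i g h B f \<pi> \<longleftrightarrow>
     \<pi> \<in> alg_hom A Q i B f \<and>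
     (\<forall>x\<in>carrier P. \<pi> (g x) = \<pi> (h x)) \<and>
     (\<forall>(C :: 'u ring) c k.
        csemiring C \<longrightarrow> c \<in> csemiring_hom A C \<longrightarrow> k \<in> alg_hom A Q i C c \<longrightarrow>
        (\<forall>x\<in>carrier P. k (g x) = k (h x)) \<longrightarrow>
        (\<exists>u\<in>alg_hom A B f C c.
           (\<forall>y\<in>carrier Q. u (\<pi> y) = k y) \<and>
           (\<forall>v\<in>alg_hom A B f C c. (\<forall>y\<in>carrier Q. v (\<pi> y) = k y) \<longrightarrow>
              (\<forall>b\<in>carrier B. v b = u b))))"

definition finitely_presented_hom :: "('u::infinite) ring \<Rightarrow> 'u ring \<Rightarrow> ('u \<Rightarrow> 'u) \<Rightarrow> bool" where
  "finitely_presented_hom A B f \<longleftrightarrow>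
     f \<in> csemiring_hom A B \<and>
     (\<exists>r d g h \<pi>.
        g \<in> alg_hom A (poly_semiring A r) (poly_const A) (poly_semiring A d) (poly_const A) \<and>
        h \<in> alg_hom A (poly_semiring A r) (poly_const A) (poly_semiring A d) (poly_const A) \<and>
        alg_coequaliser A (poly_semiring A r) (poly_semiring A d) (poly_const A) g h B f \<pi>)"


section \<open>The Zariski spectrum\<close>

definition csemiring_ideal :: "'a ring \<Rightarrow> 'a set \<Rightarrow> bool" where
  "csemiring_ideal R I \<longleftrightarrow>
     I \<subseteq> carrier R \<and> \<zero>\<^bsub>R\<^esub> \<in> I \<and> (\<forall>x\<in>I. \<forall>y\<in>I. x \<oplus>\<^bsub>R\<^esub> y \<in> I) \<and>
     (\<forall>r\<in>carrier R. \<forall>x\<in>I. r \<otimes>\<^bsub>R\<^esub> x \<in> I)"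

definition csemiring_prime :: "'a ring \<Rightarrow> 'a set \<Rightarrow> bool" where
  "csemiring_prime R \<pp> \<longleftrightarrow>
     csemiring_ideal R \<pp> \<and> \<one>\<^bsub>R\<^esub> \<in> carrier R - \<pp> \<and>
     (\<forall>a\<in>carrier R - \<pp>. \<forall>b\<in>carrier R - \<pp>. a \<otimes>\<^bsub>R\<^esub> b \<in> carrier R - \<pp>)"

definition basic_open :: "'a ring \<Rightarrow> 'a \<Rightarrow> 'a set set" where
  "basic_open R a = {\<pp>. csemiring_prime R \<pp> \<and> a \<notin> \<pp>}"

definition Spec :: "'a ring \<Rightarrow> 'a set topology" where
  "Spec R = topology_generated_by (basic_open R ` carrier R)"

definition Spec_map :: "'a ring \<Rightarrow> ('a \<Rightarrow> 'b) \<Rightarrow> 'b set \<Rightarrow> 'a set" where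
  "Spec_map A f \<qq> = {a \<in> carrier A. f a \<in> \<qq>}"

end

theory Submission
  imports Defs
begin

text \<open>
  The proof compares a prime \<open>q\<close> of \<open>B\<close> with its contraction \<open>p\<close> to \<open>A\<close>. Flatness enters through
  equalisers: an element of \<open>M \<otimes> B\<close> that satisfies \<open>h \<otimes> B = k \<otimes> B\<close> is a sum of \<open>e\<^sub>i \<otimes> b\<^sub>i\<close> with
  \<open>h e\<^sub>i = k e\<^sub>i\<close>. If a linear map \<open>\<phi> : M \<rightarrow> B\<close> contracts this element to \<open>1\<close>, then
  \<open>1 = \<Sum> \<phi> e\<^sub>i b\<^sub>i\<close>, and as \<open>1 \<notin> q\<close>, some solution \<open>e\<^sub>i\<close> of \<open>h e = k e\<close> has \<open>\<phi> e\<^sub>i \<notin> q\<close>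
  (\<open>flat_solution_outside_prime\<close>). Two instances carry the theorem.

  \<^item> In \<open>flat_epi_denominator\<close>, for \<open>b \<in> B\<close> the pairs with \<open>f a b = f c\<close> form an equaliser of maps
    \<open>A \<times> A \<rightarrow> B\<close>. The pair \<open>(1, b)\<close> solves the equation after tensoring with \<open>B\<close>, because
    \<open>b \<otimes> 1 = 1 \<otimes> b\<close> in \<open>B \<otimes>\<^sub>A B\<close> for an epimorphism. So there is \<open>a \<notin> p\<close> with \<open>f a b\<close> in the image
    of \<open>A\<close>: every \<open>b\<close> is a fraction near \<open>q\<close>.
  \<^item> In \<open>flat_annihilator\<close>, if \<open>f s = f t\<close>, then multiplication with \<open>s\<close> and with \<open>t\<close> agree after
    tensoring, so \<open>a s = a t\<close> for some \<open>a \<notin> p\<close>.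

  The first instance gives the embedding: \<open>b \<in> q\<close> is equivalent to \<open>c \<in> p\<close>, so \<open>q\<close> is determined by
  \<open>p\<close>, and the open set \<open>b \<notin> q\<close> is locally the preimage of the set where \<open>a\<close> and \<open>c\<close> are not in \<open>p\<close>.

  For openness of the image, both instances are applied to the finitely many generators and
  relations of \<open>B\<close>. Clearing denominators yields \<open>e \<notin> p\<close> such that every semiring map \<open>A \<rightarrow> C\<close> which
  inverts \<open>e\<close> factors through \<open>f\<close> (\<open>flat_fp_epi_local_section\<close>). If \<open>p'\<close> is a prime with
  \<open>e \<notin> p'\<close>, this applies to \<open>A \<rightarrow> A\<^bsub>p'\<^esub>\<close>, and the maximal ideal of \<open>A\<^bsub>p'\<^esub>\<close> pulls back to a prime of
  \<open>B\<close> over \<open>p'\<close>. Quasi-compactness of the image is inherited from \<open>Spec B\<close>.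

  The epimorphism property and the coequaliser only speak of semirings carried by the type \<open>'u\<close>.
  Therefore \<open>B \<otimes>\<^sub>A B\<close> and \<open>A\<^bsub>p'\<^esub>\<close> are constructed there, by \<open>ex_quotient_csemiring\<close>.
\<close>

section \<open>Encoding quotient semirings in an infinite type\<close>

lemma ex_pair_encoding:
  "\<exists>pr :: 'u::infinite \<Rightarrow> 'u \<Rightarrow> 'u. \<forall>a b c d. pr a b = pr c d \<longleftrightarrow> a = c \<and> b = d"
proof -
  have "(card_of ((UNIV :: 'u set) \<times> (UNIV :: 'u set)), card_of (UNIV :: 'u set)) \<in> ordIso"
    by (rule card_of_Times_same_infinite) (rule infinite_UNIV)
  then obtain h where "bij_betw h ((UNIV :: 'u set) \<times> (UNIV :: 'u set)) (UNIV :: 'u set)"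
    using card_of_ordIso by blast
  then have h: "inj h"
    by (simp add: bij_betw_def)
  show ?thesis
    by (rule exI[of _ "\<lambda>a b. h (a, b)"]) (auto dest: injD[OF h])
qed

lemma ex_inj_list: "\<exists>e :: 'u::infinite list \<Rightarrow> 'u. inj e"
proof -
  obtain pr :: "'u \<Rightarrow> 'u \<Rightarrow> 'u" where pr: "\<And>a b c d. pr a b = pr c d \<longleftrightarrow> a = c \<and> b = d"
    using ex_pair_encoding by metis
  obtain num :: "nat \<Rightarrow> 'u" where num: "inj num"
    using infinite_UNIV infinite_countable_subset by blast
  define enc where "enc xs = foldr pr xs undefined" for xs
  have enc: "xs = ys" if "length xs = length ys" "enc xs = enc ys" for xs ys
    using that by (induction xs ys rule: list_induct2) (auto simp: enc_def pr)
  have "inj (\<lambda>xs. pr (num (length xs)) (enc xs))"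
    by (rule injI) (auto simp: pr inj_eq[OF num] intro: enc)
  then show ?thesis by blast
qed

lemma ex_inj_multiset_pairs: "\<exists>e :: ('u::infinite \<times> 'u) multiset \<Rightarrow> 'u. inj e"
proof -
  obtain pr :: "'u \<Rightarrow> 'u \<Rightarrow> 'u" where pr: "\<And>a b c d. pr a b = pr c d \<longleftrightarrow> a = c \<and> b = d"
    using ex_pair_encoding by metis
  obtain e :: "'u list \<Rightarrow> 'u" where e: "inj e"
    using ex_inj_list by blast
  define l :: "('u \<times> 'u) multiset \<Rightarrow> ('u \<times> 'u) list" where "l s = (SOME xs. mset xs = s)" for s
  have l: "mset (l s) = s" for s
    unfolding l_def by (rule someI_ex) (rule ex_mset)
  have "inj l"
    by (metis injI l)
  moreover have "inj (map (\<lambda>(a, b). pr a b))"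
    by (rule inj_mapI) (auto intro!: injI simp: pr)
  ultimately have "inj (e \<circ> (map (\<lambda>(a, b). pr a b) \<circ> l))"
    using e by (intro inj_compose)
  then show ?thesis by blast
qed

lemma csemiringI:
  fixes R (structure)
  assumes "\<And>x y. \<lbrakk>x \<in> carrier R; y \<in> carrier R\<rbrakk> \<Longrightarrow> x \<oplus> y \<in> carrier R"
    and "\<zero> \<in> carrier R"
    and "\<And>x y z. \<lbrakk>x \<in> carrier R; y \<in> carrier R; z \<in> carrier R\<rbrakk> \<Longrightarrow> (x \<oplus> y) \<oplus> z = x \<oplus> (y \<oplus> z)"
    and "\<And>x. x \<in> carrier R \<Longrightarrow> \<zero> \<oplus> x = x"
    and "\<And>x y. \<lbrakk>x \<in> carrier R; y \<in> carrier R\<rbrakk> \<Longrightarrow> x \<oplus> y = y \<oplus> x"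
    and "\<And>x y. \<lbrakk>x \<in> carrier R; y \<in> carrier R\<rbrakk> \<Longrightarrow> x \<otimes> y \<in> carrier R"
    and "\<one> \<in> carrier R"
    and "\<And>x y z. \<lbrakk>x \<in> carrier R; y \<in> carrier R; z \<in> carrier R\<rbrakk> \<Longrightarrow> (x \<otimes> y) \<otimes> z = x \<otimes> (y \<otimes> z)"
    and "\<And>x. x \<in> carrier R \<Longrightarrow> \<one> \<otimes> x = x"
    and comm: "\<And>x y. \<lbrakk>x \<in> carrier R; y \<in> carrier R\<rbrakk> \<Longrightarrow> x \<otimes> y = y \<otimes> x"
    and "\<And>x y z. \<lbrakk>x \<in> carrier R; y \<in> carrier R; z \<in> carrier R\<rbrakk> \<Longrightarrow>
           (x \<oplus> y) \<otimes> z = x \<otimes> z \<oplus> y \<otimes> z"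
    and "\<And>x. x \<in> carrier R \<Longrightarrow> \<zero> \<otimes> x = \<zero>"
  shows "csemiring R"
proof -
  have *: "comm_monoid R"
    by (rule comm_monoidI) (use assms in auto)
  then interpret comm_monoid R .
  have "semiring R"
  proof (intro semiring.intro semiring_axioms.intro)
    show "abelian_monoid R"
      by (rule abelian_monoidI) (use assms in auto)
    show "Group.monoid R"
      by unfold_locales
    show "z \<otimes> (x \<oplus> y) = z \<otimes> x \<oplus> z \<otimes> y"
      if "x \<in> carrier R" "y \<in> carrier R" "z \<in> carrier R" for x y z
      using that comm[of z "x \<oplus> y"] comm[of z] assms by metis
    show "x \<otimes> \<zero> = \<zero>" if "x \<in> carrier R" for x
      using that comm[of x \<zero>] assms by metis
  qed (use assms in auto)
  then show ?thesis
    using * by (rule csemiring.intro)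
qed

text \<open>
  Encoding one representative of each class by \<open>e\<close> puts a copy of the quotient on the type \<open>'u\<close>,
  with quotient map \<open>cl\<close>. The laws are required up to the congruence only, so the lemma applies to raw
  data such as formal sums of pure tensors or fractions.
\<close>

lemma ex_quotient_csemiring:
  fixes X :: "'x set" and e :: "'x \<Rightarrow> 'u" and eq :: "'x \<Rightarrow> 'x \<Rightarrow> bool" (infix "\<asymp>" 50)
    and pl ti :: "'x \<Rightarrow> 'x \<Rightarrow> 'x" and ze un :: 'x
  assumes inj: "inj_on e X"
    and refl: "\<And>x. x \<in> X \<Longrightarrow> x \<asymp> x"
    and sym: "\<And>x y. \<lbrakk>x \<in> X; y \<in> X; x \<asymp> y\<rbrakk> \<Longrightarrow> y \<asymp> x"
    and trans: "\<And>x y z. \<lbrakk>x \<in> X; y \<in> X; z \<in> X; x \<asymp> y; y \<asymp> z\<rbrakk> \<Longrightarrow> x \<asymp> z"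
    and closed: "\<And>x y. \<lbrakk>x \<in> X; y \<in> X\<rbrakk> \<Longrightarrow> pl x y \<in> X" "\<And>x y. \<lbrakk>x \<in> X; y \<in> X\<rbrakk> \<Longrightarrow> ti x y \<in> X"
      "ze \<in> X" "un \<in> X"
    and pl_cong: "\<And>x x' y. \<lbrakk>x \<in> X; x' \<in> X; y \<in> X; x \<asymp> x'\<rbrakk> \<Longrightarrow> pl x y \<asymp> pl x' y"
    and ti_cong: "\<And>x x' y. \<lbrakk>x \<in> X; x' \<in> X; y \<in> X; x \<asymp> x'\<rbrakk> \<Longrightarrow> ti x y \<asymp> ti x' y"
    and pl_assoc: "\<And>x y z. \<lbrakk>x \<in> X; y \<in> X; z \<in> X\<rbrakk> \<Longrightarrow> pl (pl x y) z \<asymp> pl x (pl y z)"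
    and pl_comm: "\<And>x y. \<lbrakk>x \<in> X; y \<in> X\<rbrakk> \<Longrightarrow> pl x y \<asymp> pl y x"
    and pl_ze: "\<And>x. x \<in> X \<Longrightarrow> pl ze x \<asymp> x"
    and ti_assoc: "\<And>x y z. \<lbrakk>x \<in> X; y \<in> X; z \<in> X\<rbrakk> \<Longrightarrow> ti (ti x y) z \<asymp> ti x (ti y z)"
    and ti_comm: "\<And>x y. \<lbrakk>x \<in> X; y \<in> X\<rbrakk> \<Longrightarrow> ti x y \<asymp> ti y x"
    and ti_un: "\<And>x. x \<in> X \<Longrightarrow> ti un x \<asymp> x"
    and distr: "\<And>x y z. \<lbrakk>x \<in> X; y \<in> X; z \<in> X\<rbrakk> \<Longrightarrow> ti (pl x y) z \<asymp> pl (ti x z) (ti y z)"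
    and ti_ze: "\<And>x. x \<in> X \<Longrightarrow> ti ze x \<asymp> ze"
  shows "\<exists>(C :: 'u ring) cl. csemiring C \<and> carrier C = cl ` X \<and>
    (\<forall>x\<in>X. \<forall>y\<in>X. cl x = cl y \<longleftrightarrow> x \<asymp> y) \<and>
    (\<forall>x\<in>X. \<forall>y\<in>X. cl (pl x y) = cl x \<oplus>\<^bsub>C\<^esub> cl y) \<and>
    (\<forall>x\<in>X. \<forall>y\<in>X. cl (ti x y) = cl x \<otimes>\<^bsub>C\<^esub> cl y) \<and>
    cl ze = \<zero>\<^bsub>C\<^esub> \<and> cl un = \<one>\<^bsub>C\<^esub>"
proof -
  define r where "r x = (SOME y. y \<in> X \<and> x \<asymp> y)" for x
  have r: "r x \<in> X \<and> x \<asymp> r x" if "x \<in> X" for x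
    unfolding r_def by (rule someI[of _ x]) (use that refl in auto)
  define cl where "cl x = e (r x)" for x
  have r_eq: "r x = r y" if "x \<in> X" "y \<in> X" "x \<asymp> y" for x y
    unfolding r_def by (rule arg_cong[of _ _ Eps]) (use that sym trans in blast)
  have cl: "cl x = cl y \<longleftrightarrow> x \<asymp> y" if "x \<in> X" "y \<in> X" for x y
    using that r[of x] r[of y] r_eq[of x y] inj_onD[OF inj, of "r x" "r y"] sym trans
    unfolding cl_def by metis
  define rep where "rep = inv_into X cl"
  have rep: "rep (cl x) \<in> X" "rep (cl x) \<asymp> x" if "x \<in> X" for x
    using that cl[of "rep (cl x)" x] inv_into_into[of "cl x" cl X] f_inv_into_f[of "cl x" cl X]
    unfolding rep_def by auto
  define C :: "'u ring" where "C = \<lparr>carrier = cl ` X,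
    monoid.mult = (\<lambda>u v. cl (ti (rep u) (rep v))), one = cl un, zero = cl ze,
    add = (\<lambda>u v. cl (pl (rep u) (rep v)))\<rparr>"
  \<comment> \<open>By commutativity, congruence in one argument implies congruence in both.\<close>
  have two_sided: "op' x y \<asymp> op' x' y'"
    if c: "\<And>x y. \<lbrakk>x \<in> X; y \<in> X\<rbrakk> \<Longrightarrow> op' x y \<in> X"
      and l: "\<And>x x' y. \<lbrakk>x \<in> X; x' \<in> X; y \<in> X; x \<asymp> x'\<rbrakk> \<Longrightarrow> op' x y \<asymp> op' x' y"
      and s: "\<And>x y. \<lbrakk>x \<in> X; y \<in> X\<rbrakk> \<Longrightarrow> op' x y \<asymp> op' y x"
      and X: "x \<in> X" "x' \<in> X" "y \<in> X" "y' \<in> X" "x \<asymp> x'" "y \<asymp> y'" for op' x x' y y'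
  proof -
    have 1: "op' x y \<asymp> op' x' y" using l X by blast
    have 2: "op' x' y \<asymp> op' y x'" using s X by blast
    have 3: "op' y x' \<asymp> op' y' x'" using l X by blast
    have 4: "op' y' x' \<asymp> op' x' y'" using s X by blast
    have "op' x y \<asymp> op' y x'" using trans[OF _ _ _ 1 2] c X by blast
    then have "op' x y \<asymp> op' y' x'" using trans[OF _ _ _ _ 3] c X by blast
    then show ?thesis using trans[OF _ _ _ _ 4] c X by blast
  qed
  have pl: "cl x \<oplus>\<^bsub>C\<^esub> cl y = cl (pl x y)" if "x \<in> X" "y \<in> X" for x y
    using that two_sided[of pl "rep (cl x)" x "rep (cl y)" y] closed pl_cong pl_comm rep
    by (auto simp: C_def cl)
  have ti: "cl x \<otimes>\<^bsub>C\<^esub> cl y = cl (ti x y)" if "x \<in> X" "y \<in> X" for x y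
    using that two_sided[of ti "rep (cl x)" x "rep (cl y)" y] closed ti_cong ti_comm rep
    by (auto simp: C_def cl)
  have [simp]: "carrier C = cl ` X" "\<zero>\<^bsub>C\<^esub> = cl ze" "\<one>\<^bsub>C\<^esub> = cl un"
    by (simp_all add: C_def)
  have "csemiring C"
    by (rule csemiringI) (auto simp: pl ti cl closed assms)
  then show ?thesis
    by (intro exI[of _ C] exI[of _ cl]) (auto simp: pl ti cl)
qed

section \<open>Homomorphisms and prime ideals\<close>

lemma csemiring_homD:
  assumes "h \<in> csemiring_hom R S"
  shows "\<And>x. x \<in> carrier R \<Longrightarrow> h x \<in> carrier S"
    and "\<And>x y. \<lbrakk>x \<in> carrier R; y \<in> carrier R\<rbrakk> \<Longrightarrow> h (x \<otimes>\<^bsub>R\<^esub> y) = h x \<otimes>\<^bsub>S\<^esub> h y"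
    and "\<And>x y. \<lbrakk>x \<in> carrier R; y \<in> carrier R\<rbrakk> \<Longrightarrow> h (x \<oplus>\<^bsub>R\<^esub> y) = h x \<oplus>\<^bsub>S\<^esub> h y"
    and "h \<one>\<^bsub>R\<^esub> = \<one>\<^bsub>S\<^esub>" and "h \<zero>\<^bsub>R\<^esub> = \<zero>\<^bsub>S\<^esub>"
  using assms by (auto simp: csemiring_hom_def ring_hom_def)

lemma csemiring_homI:
  assumes "\<And>x. x \<in> carrier R \<Longrightarrow> h x \<in> carrier S"
    and "\<And>x y. \<lbrakk>x \<in> carrier R; y \<in> carrier R\<rbrakk> \<Longrightarrow> h (x \<otimes>\<^bsub>R\<^esub> y) = h x \<otimes>\<^bsub>S\<^esub> h y"
    and "\<And>x y. \<lbrakk>x \<in> carrier R; y \<in> carrier R\<rbrakk> \<Longrightarrow> h (x \<oplus>\<^bsub>R\<^esub> y) = h x \<oplus>\<^bsub>S\<^esub> h y"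
    and "h \<one>\<^bsub>R\<^esub> = \<one>\<^bsub>S\<^esub>" and "h \<zero>\<^bsub>R\<^esub> = \<zero>\<^bsub>S\<^esub>"
  shows "h \<in> csemiring_hom R S"
  using assms by (auto simp: csemiring_hom_def ring_hom_def)

lemma csemiring_hom_comp:
  assumes "g \<in> csemiring_hom R S" "h \<in> csemiring_hom S T"
  shows "(\<lambda>x. h (g x)) \<in> csemiring_hom R T"
  using csemiring_homD[OF assms(1)] csemiring_homD[OF assms(2)] by (intro csemiring_homI) auto

lemma csemiring_primeD:
  assumes "csemiring_prime R p"
  shows "p \<subseteq> carrier R" "\<zero>\<^bsub>R\<^esub> \<in> p" "\<one>\<^bsub>R\<^esub> \<in> carrier R" "\<one>\<^bsub>R\<^esub> \<notin> p"
    and "\<And>x y. \<lbrakk>x \<in> p; y \<in> p\<rbrakk> \<Longrightarrow> x \<oplus>\<^bsub>R\<^esub> y \<in> p"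
    and "\<And>r x. \<lbrakk>r \<in> carrier R; x \<in> p\<rbrakk> \<Longrightarrow> r \<otimes>\<^bsub>R\<^esub> x \<in> p"
    and "\<And>x y. \<lbrakk>x \<in> carrier R; y \<in> carrier R; x \<notin> p; y \<notin> p\<rbrakk> \<Longrightarrow> x \<otimes>\<^bsub>R\<^esub> y \<notin> p"
  using assms unfolding csemiring_prime_def csemiring_ideal_def by auto

lemma prime_mult_iff:
  fixes R (structure)
  assumes "csemiring R" "csemiring_prime R p" "x \<in> carrier R" "y \<in> carrier R"
  shows "x \<otimes> y \<in> p \<longleftrightarrow> x \<in> p \<or> y \<in> p"
proof -
  interpret csemiring R by fact
  show ?thesis
    using csemiring_primeD[OF assms(2)] assms(3,4) m_comm by metis
qed

lemma prime_pow:
  fixes R (structure)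
  assumes "csemiring R" "csemiring_prime R p" "x \<in> carrier R" "x \<notin> p"
  shows "x [^] (n::nat) \<notin> p"
proof -
  interpret csemiring R by fact
  show ?thesis
    by (induction n)
      (use assms csemiring_primeD[OF assms(2)] in \<open>auto simp: prime_mult_iff[OF assms(1,2)]\<close>)
qed

lemma Spec_map_prime:
  assumes "csemiring A" "f \<in> csemiring_hom A B" "csemiring_prime B q"
  shows "csemiring_prime A (Spec_map A f q)"
proof -
  interpret A: csemiring A by fact
  show ?thesis
    using csemiring_homD[OF assms(2)] csemiring_primeD[OF assms(3)]
    unfolding csemiring_prime_def csemiring_ideal_def Spec_map_def by auto
qed

text \<open>
  By Zorn's lemma there is an ideal \<open>M\<close> above \<open>I\<close> that is maximal among the proper ones. If \<open>M\<close> contains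
  neither \<open>a\<close> nor \<open>b\<close>, then \<open>\<one> = m \<oplus> r \<otimes> a\<close> for some \<open>m \<in> M\<close>. Multiplying with \<open>b\<close> shows that
  \<open>a \<otimes> b \<in> M\<close> would imply \<open>b \<in> M\<close>.
\<close>

lemma proper_ideal_in_prime:
  fixes R (structure)
  assumes R: "csemiring R" and I: "csemiring_ideal R I" "\<one> \<notin> I"
  shows "\<exists>p. csemiring_prime R p \<and> I \<subseteq> p"
proof -
  interpret csemiring R by fact
  define P where "P = {K. csemiring_ideal R K \<and> I \<subseteq> K \<and> \<one> \<notin> K}"
  have "\<exists>M\<in>P. \<forall>K\<in>P. M \<subseteq> K \<longrightarrow> K = M"
  proof (rule subset_Zorn_nonempty)
    show "P \<noteq> {}" using I by (auto simp: P_def)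
    fix \<C> assume ne: "\<C> \<noteq> {}" and ch: "subset.chain P \<C>"
    then have sub: "\<C> \<subseteq> P" and lin: "\<And>K L. \<lbrakk>K \<in> \<C>; L \<in> \<C>\<rbrakk> \<Longrightarrow> K \<subseteq> L \<or> L \<subseteq> K"
      by (auto simp: subset.chain_def)
    have "x \<oplus> y \<in> \<Union>\<C>" if "x \<in> \<Union>\<C>" "y \<in> \<Union>\<C>" for x y
    proof -
      obtain K where "K \<in> \<C>" "x \<in> K" "y \<in> K"
        using \<open>x \<in> \<Union>\<C>\<close> \<open>y \<in> \<Union>\<C>\<close> lin by blast
      moreover from this have "x \<oplus> y \<in> K"
        using sub by (auto simp: P_def csemiring_ideal_def)
      ultimately show ?thesis by blast
    qed
    moreover have "\<zero> \<in> \<Union>\<C>" "I \<subseteq> \<Union>\<C>"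
      using ne sub by (auto simp: P_def csemiring_ideal_def)
    moreover have "\<Union>\<C> \<subseteq> carrier R" "\<one> \<notin> \<Union>\<C>"
      using sub unfolding P_def csemiring_ideal_def by blast+
    moreover have "r \<otimes> x \<in> \<Union>\<C>" if "r \<in> carrier R" "x \<in> \<Union>\<C>" for r x
    proof -
      obtain K where "K \<in> \<C>" "x \<in> K" using \<open>x \<in> \<Union>\<C>\<close> by blast
      moreover from this have "r \<otimes> x \<in> K"
        using sub \<open>r \<in> carrier R\<close> by (auto simp: P_def csemiring_ideal_def)
      ultimately show ?thesis by blast
    qed
    ultimately show "\<Union>\<C> \<in> P"
      unfolding P_def csemiring_ideal_def by blast
  qed
  then obtain M where "M \<in> P" and maximal: "\<forall>K\<in>P. M \<subseteq> K \<longrightarrow> K = M"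
    by (elim bexE)
  then have M: "csemiring_ideal R M" "I \<subseteq> M" "\<one> \<notin> M"
    by (simp_all add: P_def)
  have max: "K = M" if "csemiring_ideal R K" "M \<subseteq> K" "\<one> \<notin> K" for K
    using maximal that M(2) by (auto simp: P_def)
  note Md = M(1)[unfolded csemiring_ideal_def]
  have witness: "\<exists>m\<in>M. \<exists>r\<in>carrier R. \<one> = m \<oplus> r \<otimes> a" if a: "a \<in> carrier R" "a \<notin> M" for a
  proof -
    define K where "K = {m \<oplus> r \<otimes> a | m r. m \<in> M \<and> r \<in> carrier R}"
    have "M \<subseteq> K"
    proof
      fix m assume "m \<in> M"
      moreover from this have "m = m \<oplus> \<zero> \<otimes> a" using Md a by auto
      ultimately show "m \<in> K" unfolding K_def by blast
    qed
    moreover have "a \<in> K"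
    proof -
      have "a = \<zero> \<oplus> \<one> \<otimes> a" using a by simp
      then show ?thesis unfolding K_def using Md by blast
    qed
    moreover have "csemiring_ideal R K"
      unfolding csemiring_ideal_def
    proof (intro conjI ballI)
      show "K \<subseteq> carrier R" using Md a by (auto simp: K_def)
      show "\<zero> \<in> K" using \<open>M \<subseteq> K\<close> Md by auto
    next
      fix x y assume "x \<in> K" "y \<in> K"
      then obtain m r n s where *: "m \<in> M" "r \<in> carrier R" "x = m \<oplus> r \<otimes> a"
        "n \<in> M" "s \<in> carrier R" "y = n \<oplus> s \<otimes> a"
        by (auto simp: K_def)
      then have "x \<oplus> y = (m \<oplus> n) \<oplus> (r \<oplus> s) \<otimes> a"
        using Md a by (auto simp: l_distr a_ac subset_iff)
      then show "x \<oplus> y \<in> K" unfolding K_def using * Md by blast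
    next
      fix x t assume "t \<in> carrier R" "x \<in> K"
      then obtain m r where *: "m \<in> M" "r \<in> carrier R" "x = m \<oplus> r \<otimes> a"
        by (auto simp: K_def)
      then have "t \<otimes> x = t \<otimes> m \<oplus> (t \<otimes> r) \<otimes> a"
        using Md a \<open>t \<in> carrier R\<close> by (auto simp: r_distr m_assoc subset_iff)
      then show "t \<otimes> x \<in> K" unfolding K_def using * Md \<open>t \<in> carrier R\<close> by blast
    qed
    ultimately have "\<one> \<in> K" using max[of K] a by blast
    then show ?thesis unfolding K_def by blast
  qed
  have "csemiring_prime R M"
    unfolding csemiring_prime_def
  proof (intro conjI ballI)
    fix a b assume ab: "a \<in> carrier R - M" "b \<in> carrier R - M"
    then obtain m r where *: "m \<in> M" "r \<in> carrier R" "\<one> = m \<oplus> r \<otimes> a"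
      using witness[of a] by auto
    have m: "m \<in> carrier R" using * Md by blast
    have "(m \<oplus> r \<otimes> a) \<otimes> b = b \<otimes> m \<oplus> r \<otimes> (a \<otimes> b)"
      using m *(2) ab by (simp add: l_distr m_assoc m_comm[of m b])
    then have b: "b = b \<otimes> m \<oplus> r \<otimes> (a \<otimes> b)"
      using ab unfolding *(3)[symmetric] by simp
    have "b \<otimes> m \<oplus> r \<otimes> (a \<otimes> b) \<in> M" if "a \<otimes> b \<in> M"
      using that * ab Md by blast
    then have "a \<otimes> b \<notin> M"
      using b ab by (metis DiffD2)
    then show "a \<otimes> b \<in> carrier R - M"
      using ab by simp
  qed (use M in auto)
  then show ?thesis using M by blast
qed

section \<open>The Zariski topology\<close>

lemma basic_open_mult:
  assumes "csemiring R" "a \<in> carrier R" "b \<in> carrier R"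
  shows "basic_open R (a \<otimes>\<^bsub>R\<^esub> b) = basic_open R a \<inter> basic_open R b"
  using prime_mult_iff[OF assms(1) _ assms(2,3)] by (auto simp: basic_open_def)

lemma basic_open_one: "basic_open R \<one>\<^bsub>R\<^esub> = {p. csemiring_prime R p}"
  by (auto simp: basic_open_def csemiring_prime_def)

lemma openin_Spec_basic:
  "a \<in> carrier R \<Longrightarrow> openin (Spec R) (basic_open R a)"
  unfolding Spec_def by (rule topology_generated_by_Basis) auto

lemma topspace_Spec:
  assumes "csemiring R"
  shows "topspace (Spec R) = {p. csemiring_prime R p}"
proof -
  interpret csemiring R by fact
  have "\<Union> (basic_open R ` carrier R) = basic_open R \<one>\<^bsub>R\<^esub>"
    by (auto simp: basic_open_one) (auto simp: basic_open_def)
  then show ?thesis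
    by (simp add: Spec_def basic_open_one)
qed

text \<open>The basic open sets are closed under finite intersections, so they form a base and not only a subbase.\<close>

lemma openin_Spec_iff:
  fixes R (structure)
  assumes "csemiring R"
  shows "openin (Spec R) W \<longleftrightarrow>
    W \<subseteq> {p. csemiring_prime R p} \<and> (\<forall>p\<in>W. \<exists>a\<in>carrier R. p \<in> basic_open R a \<and> basic_open R a \<subseteq> W)"
    (is "_ \<longleftrightarrow> ?R W")
proof
  interpret csemiring R by fact
  assume "openin (Spec R) W"
  then have "generate_topology_on (basic_open R ` carrier R) W"
    unfolding Spec_def by (rule openin_topology_generated_by)
  then show "?R W"
  proof induction
    case (Int V W)
    have "\<exists>c\<in>carrier R. p \<in> basic_open R c \<and> basic_open R c \<subseteq> V \<inter> W" if p: "p \<in> V \<inter> W" for p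
    proof -
      obtain a b where "a \<in> carrier R" "p \<in> basic_open R a" "basic_open R a \<subseteq> V"
        "b \<in> carrier R" "p \<in> basic_open R b" "basic_open R b \<subseteq> W"
        using Int p by blast
      then show ?thesis
        using basic_open_mult[OF assms] by (intro bexI[of _ "a \<otimes> b"]) auto
    qed
    then show ?case using Int by blast
  next
    case (UN K)
    then show ?case by (meson Sup_least Union_iff Union_upper subset_trans)
  qed (auto simp: basic_open_def)
next
  assume "?R W"
  then show "openin (Spec R) W"
    by (subst openin_subopen) (metis openin_Spec_basic)
qed

text \<open>
  The elements \<open>a\<close> for which finitely many members of a given open cover suffice to cover
  \<open>basic_open R a\<close> form an ideal. A prime ideal containing it would lie in some member \<open>V\<close> of the
  cover, together with a basic neighbourhood \<open>basic_open R a \<subseteq> V\<close>, but then \<open>a\<close> is in the ideal.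
  So the ideal contains \<open>\<one>\<close>.
\<close>

lemma compact_space_Spec:
  fixes R (structure)
  assumes "csemiring R"
  shows "compact_space (Spec R)"
proof -
  interpret csemiring R by fact
  note [simp] = topspace_Spec[OF assms]
  show ?thesis
    unfolding compact_space_alt
  proof (intro allI impI, elim conjE)
    fix \<U> assume op: "\<forall>V\<in>\<U>. openin (Spec R) V" and cov: "topspace (Spec R) \<subseteq> \<Union>\<U>"
    define I where
      "I = {a \<in> carrier R. \<exists>\<F>. finite \<F> \<and> \<F> \<subseteq> \<U> \<and> basic_open R a \<subseteq> \<Union>\<F>}"
    have ideal: "csemiring_ideal R I"
      unfolding csemiring_ideal_def
    proof (intro conjI ballI)
      show "\<zero> \<in> I"
        by (auto simp: I_def basic_open_def csemiring_prime_def csemiring_ideal_def intro!: exI[of _ "{}"])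
    next
      fix a b assume "a \<in> I" "b \<in> I"
      then obtain \<F> \<G> where *: "a \<in> carrier R" "b \<in> carrier R" "finite \<F>" "\<F> \<subseteq> \<U>"
        "basic_open R a \<subseteq> \<Union>\<F>" "finite \<G>" "\<G> \<subseteq> \<U>" "basic_open R b \<subseteq> \<Union>\<G>"
        by (auto simp: I_def)
      moreover have "basic_open R (a \<oplus> b) \<subseteq> basic_open R a \<union> basic_open R b"
        by (auto simp: basic_open_def csemiring_primeD)
      ultimately show "a \<oplus> b \<in> I"
        unfolding I_def by (intro CollectI conjI exI[of _ "\<F> \<union> \<G>"]) auto
    next
      fix r a assume "r \<in> carrier R" "a \<in> I"
      then show "r \<otimes> a \<in> I"
        using basic_open_mult[OF assms, of r a] unfolding I_def by auto
    qed (auto simp: I_def)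
    have "\<one> \<in> I"
    proof (rule ccontr)
      assume "\<one> \<notin> I"
      then obtain p where p: "csemiring_prime R p" "I \<subseteq> p"
        using proper_ideal_in_prime[OF assms ideal] by blast
      then obtain V where V: "V \<in> \<U>" "p \<in> V"
        using cov by auto
      then obtain a where "a \<in> carrier R" "p \<in> basic_open R a" "basic_open R a \<subseteq> V"
        using op openin_Spec_iff[OF assms] by meson
      then have "a \<in> I"
        using V by (auto simp: I_def intro!: exI[of _ "{V}"])
      then show False
        using p \<open>p \<in> basic_open R a\<close> by (auto simp: basic_open_def)
    qed
    then show "\<exists>\<F>. finite \<F> \<and> \<F> \<subseteq> \<U> \<and> topspace (Spec R) \<subseteq> \<Union>\<F>"
      unfolding I_def by (simp add: basic_open_one)
  qed
qed

lemma continuous_map_Spec_map: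
  assumes "csemiring A" "csemiring B" "f \<in> csemiring_hom A B"
  shows "continuous_map (Spec B) (Spec A) (Spec_map A f)"
proof -
  interpret A: csemiring A by fact
  note tops = topspace_Spec[OF assms(1)] topspace_Spec[OF assms(2)]
  show ?thesis
    unfolding Spec_def[of A]
  proof (rule continuous_on_generated_topo)
    fix U assume "U \<in> basic_open A ` carrier A"
    then obtain a where a: "a \<in> carrier A" "U = basic_open A a" by blast
    have "Spec_map A f -` U \<inter> topspace (Spec B) = basic_open B (f a)"
      using a Spec_map_prime[OF assms(1,3)] by (auto simp: tops basic_open_def Spec_map_def)
    then show "openin (Spec B) (Spec_map A f -` U \<inter> topspace (Spec B))"
      using a csemiring_homD(1)[OF assms(3)] openin_Spec_basic by metis
  next
    have "basic_open A \<one>\<^bsub>A\<^esub> \<subseteq> \<Union> (basic_open A ` carrier A)"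
      by auto
    then show "Spec_map A f ` topspace (Spec B) \<subseteq> \<Union> (basic_open A ` carrier A)"
      using Spec_map_prime[OF assms(1,3)] by (auto simp: tops basic_open_one)
  qed
qed

section \<open>Sums of finite multisets in a commutative monoid\<close>

text \<open>
  Folding needs an operation that commutes on the whole type; addition does so only on the carrier,
  so the guard makes it trivial elsewhere.
\<close>

definition multiset_sum :: "('a, 'm) ring_scheme \<Rightarrow> 'a multiset \<Rightarrow> 'a" where
  "multiset_sum R s =
     fold_mset (\<lambda>x y. if x \<in> carrier R \<and> y \<in> carrier R then x \<oplus>\<^bsub>R\<^esub> y else y) \<zero>\<^bsub>R\<^esub> s"

context abelian_monoid
begin

lemma comp_fun_commute_guarded_add:
  "comp_fun_commute (\<lambda>x y. if x \<in> carrier G \<and> y \<in> carrier G then x \<oplus> y else y)"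
  by unfold_locales (auto simp: fun_eq_iff a_lcomm)

lemma multiset_sum_empty [simp]: "multiset_sum G {#} = \<zero>"
  by (simp add: multiset_sum_def)

lemma multiset_sum_closed [simp]:
  "set_mset s \<subseteq> carrier G \<Longrightarrow> multiset_sum G s \<in> carrier G"
  by (induction s)
    (auto simp: multiset_sum_def comp_fun_commute.fold_mset_add_mset[OF comp_fun_commute_guarded_add])

lemma multiset_sum_add_mset [simp]:
  "\<lbrakk>x \<in> carrier G; set_mset s \<subseteq> carrier G\<rbrakk> \<Longrightarrow>
     multiset_sum G (add_mset x s) = x \<oplus> multiset_sum G s"
  using multiset_sum_closed[of s]
  by (simp add: multiset_sum_def comp_fun_commute.fold_mset_add_mset[OF comp_fun_commute_guarded_add])

lemma multiset_sum_plus: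
  "\<lbrakk>set_mset s \<subseteq> carrier G; set_mset t \<subseteq> carrier G\<rbrakk> \<Longrightarrow>
     multiset_sum G (s + t) = multiset_sum G s \<oplus> multiset_sum G t"
  by (induction s) (auto simp: a_assoc)

end

section \<open>Modules and tensor products\<close>

lemma semimoduleI:
  fixes R (structure) and M (structure)
  assumes "csemiring R"
    and "\<And>x y. \<lbrakk>x \<in> carrier M; y \<in> carrier M\<rbrakk> \<Longrightarrow> x \<oplus>\<^bsub>M\<^esub> y \<in> carrier M"
    and "\<zero>\<^bsub>M\<^esub> \<in> carrier M"
    and "\<And>x y z. \<lbrakk>x \<in> carrier M; y \<in> carrier M; z \<in> carrier M\<rbrakk> \<Longrightarrow>
           (x \<oplus>\<^bsub>M\<^esub> y) \<oplus>\<^bsub>M\<^esub> z = x \<oplus>\<^bsub>M\<^esub> (y \<oplus>\<^bsub>M\<^esub> z)"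
    and "\<And>x. x \<in> carrier M \<Longrightarrow> \<zero>\<^bsub>M\<^esub> \<oplus>\<^bsub>M\<^esub> x = x"
    and "\<And>x y. \<lbrakk>x \<in> carrier M; y \<in> carrier M\<rbrakk> \<Longrightarrow> x \<oplus>\<^bsub>M\<^esub> y = y \<oplus>\<^bsub>M\<^esub> x"
    and "\<And>a x. \<lbrakk>a \<in> carrier R; x \<in> carrier M\<rbrakk> \<Longrightarrow> a \<odot>\<^bsub>M\<^esub> x \<in> carrier M"
    and "\<And>a b x. \<lbrakk>a \<in> carrier R; b \<in> carrier R; x \<in> carrier M\<rbrakk> \<Longrightarrow>
           (a \<oplus> b) \<odot>\<^bsub>M\<^esub> x = a \<odot>\<^bsub>M\<^esub> x \<oplus>\<^bsub>M\<^esub> b \<odot>\<^bsub>M\<^esub> x"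
    and "\<And>a x y. \<lbrakk>a \<in> carrier R; x \<in> carrier M; y \<in> carrier M\<rbrakk> \<Longrightarrow>
           a \<odot>\<^bsub>M\<^esub> (x \<oplus>\<^bsub>M\<^esub> y) = a \<odot>\<^bsub>M\<^esub> x \<oplus>\<^bsub>M\<^esub> a \<odot>\<^bsub>M\<^esub> y"
    and "\<And>a b x. \<lbrakk>a \<in> carrier R; b \<in> carrier R; x \<in> carrier M\<rbrakk> \<Longrightarrow>
           (a \<otimes> b) \<odot>\<^bsub>M\<^esub> x = a \<odot>\<^bsub>M\<^esub> (b \<odot>\<^bsub>M\<^esub> x)"
    and "\<And>x. x \<in> carrier M \<Longrightarrow> \<one> \<odot>\<^bsub>M\<^esub> x = x"
    and "\<And>x. x \<in> carrier M \<Longrightarrow> \<zero> \<odot>\<^bsub>M\<^esub> x = \<zero>\<^bsub>M\<^esub>"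
    and "\<And>a. a \<in> carrier R \<Longrightarrow> a \<odot>\<^bsub>M\<^esub> \<zero>\<^bsub>M\<^esub> = \<zero>\<^bsub>M\<^esub>"
  shows "semimodule R M"
proof (intro semimodule.intro semimodule_axioms.intro)
  show "abelian_monoid M"
    by (rule abelian_monoidI) (use assms in auto)
qed (use assms in auto)

lemma semimodule_homD:
  assumes "h \<in> semimodule_hom A M N"
  shows "\<And>x. x \<in> carrier M \<Longrightarrow> h x \<in> carrier N"
    and "h \<zero>\<^bsub>M\<^esub> = \<zero>\<^bsub>N\<^esub>"
    and "\<And>x y. \<lbrakk>x \<in> carrier M; y \<in> carrier M\<rbrakk> \<Longrightarrow> h (x \<oplus>\<^bsub>M\<^esub> y) = h x \<oplus>\<^bsub>N\<^esub> h y"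
    and "\<And>a x. \<lbrakk>a \<in> carrier A; x \<in> carrier M\<rbrakk> \<Longrightarrow> h (a \<odot>\<^bsub>M\<^esub> x) = a \<odot>\<^bsub>N\<^esub> h x"
  using assms by (auto simp: semimodule_hom_def)

lemma semimodule_homI:
  assumes "\<And>x. x \<in> carrier M \<Longrightarrow> h x \<in> carrier N"
    and "h \<zero>\<^bsub>M\<^esub> = \<zero>\<^bsub>N\<^esub>"
    and "\<And>x y. \<lbrakk>x \<in> carrier M; y \<in> carrier M\<rbrakk> \<Longrightarrow> h (x \<oplus>\<^bsub>M\<^esub> y) = h x \<oplus>\<^bsub>N\<^esub> h y"
    and "\<And>a x. \<lbrakk>a \<in> carrier A; x \<in> carrier M\<rbrakk> \<Longrightarrow> h (a \<odot>\<^bsub>M\<^esub> x) = a \<odot>\<^bsub>N\<^esub> h x"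
  shows "h \<in> semimodule_hom A M N"
  using assms by (auto simp: semimodule_hom_def)

lemma module_via_simps [simp]:
  "carrier (module_via f B) = carrier B"
  "\<zero>\<^bsub>module_via f B\<^esub> = \<zero>\<^bsub>B\<^esub>"
  "x \<oplus>\<^bsub>module_via f B\<^esub> y = x \<oplus>\<^bsub>B\<^esub> y"
  "a \<odot>\<^bsub>module_via f B\<^esub> x = f a \<otimes>\<^bsub>B\<^esub> x"
  by (simp_all add: module_via_def)

lemma semimodule_via:
  assumes "csemiring A" "csemiring B" "f \<in> csemiring_hom A B"
  shows "semimodule A (module_via f B)"
proof -
  interpret B: csemiring B by fact
  note [simp] = csemiring_homD[OF assms(3)]
  show ?thesis
    by (rule semimoduleI[OF assms(1)]) (auto simp: B.a_ac B.m_assoc B.l_distr B.r_distr)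
qed

lemma UN_eq_const: "\<lbrakk>a \<in> S; \<And>x. x \<in> S \<Longrightarrow> F x = c\<rbrakk> \<Longrightarrow> (\<Union>x\<in>S. F x) = c"
  by (rule SUP_eq_const) auto

lemma mem_tensor_class_iff: "t \<in> tensor_class A M N s \<longleftrightarrow> tensor_cong A M N s t"
  by (simp add: tensor_class_def)

locale semimodule_pair =
  M: semimodule A M + N: semimodule A N
  for A :: "'a ring" and M :: "('a, 'b) module" and N :: "('a, 'c) module"
begin

abbreviation formal_sum :: "('b \<times> 'c) multiset \<Rightarrow> bool" where
  "formal_sum s \<equiv> set_mset s \<subseteq> carrier M \<times> carrier N"

lemma tensor_cong_formal_sum:
  "tensor_cong A M N s t \<Longrightarrow> formal_sum s \<and> formal_sum t"
  by (induction rule: tensor_cong.induct) auto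

lemma mem_tensor_class: "formal_sum s \<Longrightarrow> s \<in> tensor_class A M N s"
  by (simp add: tensor_class_def tensor_cong.refl)

lemma tensor_class_eq_iff:
  assumes "formal_sum s"
  shows "tensor_class A M N s = tensor_class A M N t \<longleftrightarrow> tensor_cong A M N s t"
proof
  assume "tensor_class A M N s = tensor_class A M N t"
  then have "s \<in> tensor_class A M N t"
    using mem_tensor_class[OF assms] by simp
  then show "tensor_cong A M N s t"
    by (auto simp: tensor_class_def intro: tensor_cong.sym)
next
  assume "tensor_cong A M N s t"
  then show "tensor_class A M N s = tensor_class A M N t"
    unfolding tensor_class_def using tensor_cong.sym tensor_cong.trans by blast
qed

lemma carrier_tensor: "carrier (tensor A M N) = tensor_class A M N ` {s. formal_sum s}"
  by (simp add: tensor_def)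

lemma tensor_class_closed:
  "formal_sum s \<Longrightarrow> tensor_class A M N s \<in> tensor_class A M N ` {s. formal_sum s}"
  by blast

lemma zero_tensor: "\<zero>\<^bsub>tensor A M N\<^esub> = tensor_class A M N {#}"
  by (simp add: tensor_def)

lemma add_tensor:
  assumes "formal_sum s" "formal_sum t"
  shows "tensor_class A M N s \<oplus>\<^bsub>tensor A M N\<^esub> tensor_class A M N t = tensor_class A M N (s + t)"
proof -
  have step: "tensor_class A M N (s' + t') = tensor_class A M N (s + t)"
    if "s' \<in> tensor_class A M N s" "t' \<in> tensor_class A M N t" for s' t'
    using that tensor_cong.plus[of A M N s s' t t'] assms tensor_class_eq_iff[of "s + t" "s' + t'"]
    by (simp add: mem_tensor_class_iff)
  have inner: "(\<Union>t'\<in>tensor_class A M N t. tensor_class A M N (s' + t')) = tensor_class A M N (s + t)"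
    if "s' \<in> tensor_class A M N s" for s'
    by (rule UN_eq_const[OF mem_tensor_class[OF assms(2)]]) (rule step[OF that])
  have "(\<Union>s'\<in>tensor_class A M N s. \<Union>t'\<in>tensor_class A M N t. tensor_class A M N (s' + t')) =
      tensor_class A M N (s + t)"
    by (rule UN_eq_const[OF mem_tensor_class[OF assms(1)]]) (rule inner)
  then show ?thesis
    by (simp add: tensor_def)
qed

abbreviation scale :: "'a \<Rightarrow> ('b \<times> 'c) multiset \<Rightarrow> ('b \<times> 'c) multiset" where
  "scale a \<equiv> image_mset (\<lambda>(x, y). (a \<odot>\<^bsub>M\<^esub> x, y))"

lemma formal_sum_scale: "\<lbrakk>a \<in> carrier A; formal_sum s\<rbrakk> \<Longrightarrow> formal_sum (scale a s)"
  by auto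

lemma tensor_cong_scale:
  assumes "a \<in> carrier A" "tensor_cong A M N s t"
  shows "tensor_cong A M N (scale a s) (scale a t)"
  using assms(2)
proof (induction rule: tensor_cong.induct)
  case (refl s)
  then show ?case using assms(1) by (intro tensor_cong.refl) auto
next
  case (smult b x y)
  moreover have "a \<odot>\<^bsub>M\<^esub> (b \<odot>\<^bsub>M\<^esub> x) = b \<odot>\<^bsub>M\<^esub> (a \<odot>\<^bsub>M\<^esub> x)"
    using smult assms(1) by (metis M.smult_assoc M.R.m_comm)
  ultimately show ?case
    using assms(1) by (auto intro: tensor_cong.smult)
qed (use assms(1) in \<open>auto simp: M.smult_r_distr intro: tensor_cong.intros\<close>)

lemma smult_tensor:
  assumes "a \<in> carrier A" "formal_sum s"
  shows "a \<odot>\<^bsub>tensor A M N\<^esub> tensor_class A M N s = tensor_class A M N (scale a s)"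
proof -
  have step: "tensor_class A M N (scale a s') = tensor_class A M N (scale a s)"
    if "s' \<in> tensor_class A M N s" for s'
    using that tensor_class_eq_iff[OF formal_sum_scale[OF assms], of "scale a s'"]
      tensor_cong_scale[OF assms(1)] by (simp add: mem_tensor_class_iff)
  have "(\<Union>s'\<in>tensor_class A M N s. tensor_class A M N (scale a s')) =
      tensor_class A M N (scale a s)"
    by (rule UN_eq_const[OF mem_tensor_class[OF assms(2)]]) (rule step)
  then show ?thesis
    by (simp add: tensor_def)
qed

lemma tensor_semimodule: "semimodule A (tensor A M N)"
proof -
  note simps = carrier_tensor zero_tensor add_tensor smult_tensor tensor_class_eq_iff
  \<comment> \<open>Only these two laws use the relations of the tensor product; the other ones hold for formal sums.\<close>
  have distr: "tensor_cong A M N (scale (a \<oplus>\<^bsub>A\<^esub> b) s) (scale a s + scale b s)"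
    if ab: "a \<in> carrier A" "b \<in> carrier A" and s: "formal_sum s" for a b s
    using s
  proof (induction s)
    case empty
    show ?case by (auto intro: tensor_cong.refl)
  next
    case (add z s)
    obtain x y where z: "z = (x, y)" "x \<in> carrier M" "y \<in> carrier N"
      using add by auto
    have "tensor_cong A M N {#((a \<oplus>\<^bsub>A\<^esub> b) \<odot>\<^bsub>M\<^esub> x, y)#} {#(a \<odot>\<^bsub>M\<^esub> x, y), (b \<odot>\<^bsub>M\<^esub> x, y)#}"
      using z ab by (auto simp: M.smult_l_distr intro: tensor_cong.add_left)
    from tensor_cong.plus[OF this add.IH] show ?case
      using add.prems z by (simp add: add_mset_commute)
  qed
  have null: "tensor_cong A M N (scale \<zero>\<^bsub>A\<^esub> s) {#}" if "formal_sum s" for s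
    using that
  proof (induction s)
    case empty
    show ?case by (auto intro: tensor_cong.refl)
  next
    case (add z s)
    obtain x y where z: "z = (x, y)" "x \<in> carrier M" "y \<in> carrier N"
      using add by auto
    have "tensor_cong A M N {#(\<zero>\<^bsub>M\<^esub>, y)#} {#}"
      using z by (auto intro: tensor_cong.zero_left)
    from tensor_cong.plus[OF this add.IH] show ?case
      using add.prems z by simp
  qed
  have assoc: "scale (a \<otimes>\<^bsub>A\<^esub> b) s = scale a (scale b s)"
    if "a \<in> carrier A" "b \<in> carrier A" "formal_sum s" for a b s
    using that by (auto simp: multiset.map_comp M.smult_assoc intro!: image_mset_cong)
  have one: "scale \<one>\<^bsub>A\<^esub> s = s" if "formal_sum s" for s
    using that by (induction s) auto
  show ?thesis
  proof (rule semimoduleI)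
    show "csemiring A" by (rule M.R.csemiring_axioms)
  next
    fix a b x
    assume ab: "a \<in> carrier A" "b \<in> carrier A" and "x \<in> carrier (tensor A M N)"
    then obtain s where s: "formal_sum s" "x = tensor_class A M N s"
      by (auto simp: carrier_tensor)
    have "tensor_class A M N (scale (a \<oplus>\<^bsub>A\<^esub> b) s) = tensor_class A M N (scale a s + scale b s)"
      using distr[OF ab s(1)] tensor_class_eq_iff[OF formal_sum_scale[OF _ s(1)]] ab by simp
    then show "(a \<oplus>\<^bsub>A\<^esub> b) \<odot>\<^bsub>tensor A M N\<^esub> x =
        a \<odot>\<^bsub>tensor A M N\<^esub> x \<oplus>\<^bsub>tensor A M N\<^esub> b \<odot>\<^bsub>tensor A M N\<^esub> x"
      using ab s by (simp add: add_tensor smult_tensor formal_sum_scale del: set_image_mset)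
  next
    fix a b x
    assume "a \<in> carrier A" "b \<in> carrier A" "x \<in> carrier (tensor A M N)"
    then show "(a \<otimes>\<^bsub>A\<^esub> b) \<odot>\<^bsub>tensor A M N\<^esub> x =
        a \<odot>\<^bsub>tensor A M N\<^esub> (b \<odot>\<^bsub>tensor A M N\<^esub> x)"
      by (auto simp: simps formal_sum_scale assoc simp del: set_image_mset)
  next
    fix x assume "x \<in> carrier (tensor A M N)"
    then obtain s where s: "formal_sum s" "x = tensor_class A M N s"
      by (auto simp: carrier_tensor)
    have "tensor_class A M N (scale \<zero>\<^bsub>A\<^esub> s) = tensor_class A M N {#}"
      using null[OF s(1)] tensor_class_eq_iff[OF formal_sum_scale[OF _ s(1)]] by simp
    then show "\<zero>\<^bsub>A\<^esub> \<odot>\<^bsub>tensor A M N\<^esub> x = \<zero>\<^bsub>tensor A M N\<^esub>"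
      using s by (simp add: zero_tensor smult_tensor del: set_image_mset)
  qed (auto simp: simps formal_sum_scale one add_ac tensor_class_closed
      simp del: set_image_mset)
qed

end

lemma tensor_cong_map:
  assumes "h \<in> semimodule_hom A M M'" "tensor_cong A M N s t"
  shows "tensor_cong A M' N (image_mset (map_prod h id) s) (image_mset (map_prod h id) t)"
  using assms(2)
proof (induction rule: tensor_cong.induct)
  case (refl s)
  then show ?case
    using semimodule_homD(1)[OF assms(1)] by (intro tensor_cong.refl) auto
qed (auto simp: semimodule_homD[OF assms(1)] intro: tensor_cong.intros)

lemma tensor_map_class:
  assumes "semimodule A M" "semimodule A M'" "semimodule A N" "h \<in> semimodule_hom A M M'"
    and s: "set_mset s \<subseteq> carrier M \<times> carrier N"
  shows "tensor_map A M' N h (tensor_class A M N s) =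
    tensor_class A M' N (image_mset (map_prod h id) s)"
proof -
  interpret MN: semimodule_pair A M N
    using assms by (simp add: semimodule_pair_def)
  interpret MN': semimodule_pair A M' N
    using assms by (simp add: semimodule_pair_def)
  have step: "tensor_class A M' N (image_mset (map_prod h id) s') =
      tensor_class A M' N (image_mset (map_prod h id) s)" if "s' \<in> tensor_class A M N s" for s'
    using that tensor_cong_map[OF assms(4) tensor_cong.sym] MN'.tensor_class_eq_iff
      MN'.tensor_cong_formal_sum unfolding mem_tensor_class_iff by blast
  show ?thesis
    unfolding tensor_map_def by (rule UN_eq_const[OF MN.mem_tensor_class[OF s]]) (rule step)
qed

lemma tensor_map_hom:
  assumes "semimodule A M" "semimodule A M'" "semimodule A N" "h \<in> semimodule_hom A M M'"
  shows "tensor_map A M' N h \<in> semimodule_hom A (tensor A M N) (tensor A M' N)"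
proof -
  interpret MN: semimodule_pair A M N
    using assms by (simp add: semimodule_pair_def)
  interpret MN': semimodule_pair A M' N
    using assms by (simp add: semimodule_pair_def)
  have map: "MN'.formal_sum (image_mset (map_prod h id) s)" if "MN.formal_sum s" for s
    using that semimodule_homD(1)[OF assms(4)] by auto
  have scale: "image_mset (map_prod h id) (MN.scale a s) =
      MN'.scale a (image_mset (map_prod h id) s)"
    if "a \<in> carrier A" "MN.formal_sum s" for a s
    using that semimodule_homD(4)[OF assms(4)]
    by (auto simp: multiset.map_comp intro!: image_mset_cong)
  note simps = MN.carrier_tensor MN.zero_tensor MN.add_tensor MN.smult_tensor
    MN'.carrier_tensor MN'.zero_tensor MN'.add_tensor MN'.smult_tensor
  show ?thesis
    by (rule semimodule_homI)
      (auto simp: simps tensor_map_class[OF assms] map scale MN.formal_sum_scale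
        simp del: set_image_mset)
qed

text \<open>
  On representatives, the linear map \<open>M \<otimes> B \<rightarrow> B\<close> that corresponds to a linear map \<open>\<phi> : M \<rightarrow> B\<close> by
  extension of scalars.
\<close>

definition contract :: "'b ring \<Rightarrow> ('m \<Rightarrow> 'b) \<Rightarrow> ('m \<times> 'b) multiset \<Rightarrow> 'b" where
  "contract B \<phi> s = multiset_sum B (image_mset (\<lambda>(m, x). \<phi> m \<otimes>\<^bsub>B\<^esub> x) s)"

lemma contract_cong:
  assumes A: "csemiring A" and B: "csemiring B" and f: "f \<in> csemiring_hom A B"
    and M: "semimodule A M" and \<phi>: "\<phi> \<in> semimodule_hom A M (module_via f B)"
    and cong: "tensor_cong A M (module_via f B) s t"
  shows "contract B \<phi> s = contract B \<phi> t"
proof -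
  interpret B: csemiring B by fact
  interpret semimodule_pair A M "module_via f B"
    using M semimodule_via[OF A B f] by (simp add: semimodule_pair_def)
  note [simp] = semimodule_homD[OF \<phi>, simplified] csemiring_homD(1)[OF f]
  have closed: "set_mset (image_mset (\<lambda>(m, x). \<phi> m \<otimes>\<^bsub>B\<^esub> x) s) \<subseteq> carrier B" if "formal_sum s" for s
    using that by auto
  have "formal_sum s \<and> formal_sum t \<and> contract B \<phi> s = contract B \<phi> t"
    using cong
  proof (induction rule: tensor_cong.induct)
    case (plus s t s' t')
    then show ?case
      by (simp add: contract_def B.multiset_sum_plus closed del: set_image_mset)
  qed (auto simp: contract_def B.l_distr B.r_distr B.m_ac)
  then show ?thesis by blast
qed

section \<open>Flatness and equalisers\<close>

text \<open>The arrows \<open>0\<close> and \<open>1\<close> are the identities, \<open>2\<close> and \<open>3\<close> the two parallel arrows.\<close>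

definition parallel_pair :: small_category where
  "parallel_pair = \<lparr>objs = {0, 1}, arrs = {0, 1, 2, 3}, src = (\<lambda>e. if e = 1 then 1 else 0),
     tgt = (\<lambda>e. if e = 0 then 0 else 1), ident = (\<lambda>j. j),
     arr_comp = (\<lambda>e' e. if e \<le> 1 then e' else e)\<rparr>"

lemma finite_category_parallel_pair: "finite_category parallel_pair"
  by unfold_locales (auto simp: parallel_pair_def)

abbreviation pair_objects :: "'m \<Rightarrow> 'm \<Rightarrow> nat \<Rightarrow> 'm" where
  "pair_objects M M' j \<equiv> if j = 0 then M else M'"

abbreviation pair_arrows :: "('m \<Rightarrow> 'm) \<Rightarrow> ('m \<Rightarrow> 'm) \<Rightarrow> nat \<Rightarrow> 'm \<Rightarrow> 'm" where
  "pair_arrows h k e \<equiv> if e \<le> 1 then (\<lambda>x. x) else if e = 2 then h else k"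

definition equaliser :: "('a, 'b) module \<Rightarrow> ('b \<Rightarrow> 'c) \<Rightarrow> ('b \<Rightarrow> 'c) \<Rightarrow> ('a, 'b) module" where
  "equaliser M h k = M\<lparr>carrier := {x \<in> carrier M. h x = k x}\<rparr>"

lemma equaliser_simps [simp]:
  "carrier (equaliser M h k) = {x \<in> carrier M. h x = k x}"
  "\<zero>\<^bsub>equaliser M h k\<^esub> = \<zero>\<^bsub>M\<^esub>"
  "x \<oplus>\<^bsub>equaliser M h k\<^esub> y = x \<oplus>\<^bsub>M\<^esub> y"
  "a \<odot>\<^bsub>equaliser M h k\<^esub> x = a \<odot>\<^bsub>M\<^esub> x"
  by (simp_all add: equaliser_def)

lemma equaliser_semimodule:
  assumes "semimodule A M" "h \<in> semimodule_hom A M M'" "k \<in> semimodule_hom A M M'"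
  shows "semimodule A (equaliser M h k)"
proof -
  interpret semimodule A M by fact
  note [simp] = semimodule_homD[OF assms(2)] semimodule_homD[OF assms(3)]
  show ?thesis
    by (rule semimoduleI[OF R.csemiring_axioms])
      (auto simp: M.a_ac smult_l_distr smult_r_distr smult_assoc)
qed

lemma equaliser_limit:
  assumes "semimodule A M" "semimodule A M'"
    "h \<in> semimodule_hom A M M'" "k \<in> semimodule_hom A M M'"
  shows "module_limit_cone A parallel_pair (pair_objects M M') (pair_arrows h k)
    (equaliser M h k) (\<lambda>j. if j = 0 then (\<lambda>x. x) else h)"
  unfolding module_limit_cone_def
proof (intro conjI allI impI)
  show "module_cone A parallel_pair (pair_objects M M') (pair_arrows h k)
      (equaliser M h k) (\<lambda>j. if j = 0 then (\<lambda>x. x) else h)"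
    using assms(3) equaliser_semimodule[OF assms(1,3,4)]
    by (auto simp: module_cone_def parallel_pair_def semimodule_hom_def)
next
  fix Q q assume "module_cone A parallel_pair (pair_objects M M') (pair_arrows h k) Q q"
  then have q: "q 0 \<in> semimodule_hom A Q M" and
    hk: "\<And>x. x \<in> carrier Q \<Longrightarrow> h (q 0 x) = q 1 x" "\<And>x. x \<in> carrier Q \<Longrightarrow> k (q 0 x) = q 1 x"
    by (auto simp: module_cone_def parallel_pair_def)
  have "q 0 \<in> semimodule_hom A Q (equaliser M h k)"
    using q hk by (auto simp: semimodule_hom_def)
  then show "\<exists>u\<in>semimodule_hom A Q (equaliser M h k).
      (\<forall>j\<in>objs parallel_pair. \<forall>x\<in>carrier Q. (if j = 0 then (\<lambda>x. x) else h) (u x) = q j x) \<and>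
      (\<forall>v\<in>semimodule_hom A Q (equaliser M h k).
         (\<forall>j\<in>objs parallel_pair. \<forall>x\<in>carrier Q. (if j = 0 then (\<lambda>x. x) else h) (v x) = q j x) \<longrightarrow>
         (\<forall>x\<in>carrier Q. v x = u x))"
    using hk by (intro bexI[of _ "q 0"]) (auto simp: parallel_pair_def)
qed

text \<open>
  Tensoring with \<open>N\<close> maps the equaliser \<open>E\<close> of \<open>h\<close> and \<open>k\<close> to a limit cone, through which the equaliser
  of \<open>h \<otimes> N\<close> and \<open>k \<otimes> N\<close> factors. The class of \<open>s\<close> belongs to the latter, so it comes from \<open>E \<otimes> N\<close>.
\<close>

lemma flat_equaliser:
  fixes A :: "('u::infinite) ring" and M M' N :: "('u, 'u) module"
  assumes flat: "flat_module A N"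
    and M: "semimodule A M" and M': "semimodule A M'"
    and h: "h \<in> semimodule_hom A M M'" and k: "k \<in> semimodule_hom A M M'"
    and s: "set_mset s \<subseteq> carrier M \<times> carrier N"
    and eq: "tensor_cong A M' N (image_mset (map_prod h id) s) (image_mset (map_prod k id) s)"
  shows "\<exists>t. set_mset t \<subseteq> {x \<in> carrier M. h x = k x} \<times> carrier N \<and> tensor_cong A M N t s"
proof -
  have N: "semimodule A N"
    using flat by (simp add: flat_module_def)
  define E where "E = equaliser M h k"
  have E: "semimodule A E"
    unfolding E_def using equaliser_semimodule[OF M h k] .
  interpret MN: semimodule_pair A M N using M N by (simp add: semimodule_pair_def)
  interpret MN': semimodule_pair A M' N using M' N by (simp add: semimodule_pair_def)
  interpret EN: semimodule_pair A E N using E N by (simp add: semimodule_pair_def)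
  let ?F = "pair_objects M M'" and ?\<phi> = "pair_arrows h k"
  let ?TF = "\<lambda>j. tensor A (?F j) N"
  let ?T\<phi> = "\<lambda>e. tensor_map A (?F (tgt parallel_pair e)) N (?\<phi> e)"
  have id_M: "(\<lambda>x. x) \<in> semimodule_hom A M M" and id_M': "(\<lambda>x. x) \<in> semimodule_hom A M' M'"
    and incl: "(\<lambda>x. x) \<in> semimodule_hom A E M"
    by (auto simp: semimodule_hom_def E_def)
  have "module_diagram A parallel_pair ?F ?\<phi>"
    using M M' h k id_M id_M' by (auto simp: module_diagram_def parallel_pair_def)
  with flat equaliser_limit[OF M M' h k] finite_category_parallel_pair
  have limit: "module_limit_cone A parallel_pair ?TF ?T\<phi> (tensor A E N)
      (\<lambda>j. tensor_map A (?F j) N (if j = 0 then (\<lambda>x. x) else h))"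
    unfolding flat_module_def E_def by blast
  \<comment> \<open>The given element lies in the equaliser of \<open>h \<otimes> N\<close> and \<open>k \<otimes> N\<close>, which is the vertex of a cone.\<close>
  let ?hN = "tensor_map A M' N h" and ?kN = "tensor_map A M' N k"
  define Q where "Q = equaliser (tensor A M N) ?hN ?kN"
  define q where "q j = (if j = (0::nat) then (\<lambda>x. x) else ?hN)" for j
  have hN: "?hN \<in> semimodule_hom A (tensor A M N) (tensor A M' N)"
    and kN: "?kN \<in> semimodule_hom A (tensor A M N) (tensor A M' N)"
    using tensor_map_hom M M' N h k by blast+
  have id_tensor: "tensor_map A L N (\<lambda>x. x) z = z"
    if "semimodule A L" "z \<in> carrier (tensor A L N)" for L :: "('u, 'u) module" and z
  proof -
    interpret LN: semimodule_pair A L N using that N by (simp add: semimodule_pair_def)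
    have "(\<lambda>x. x) \<in> semimodule_hom A L L" by (auto simp: semimodule_hom_def)
    then show ?thesis
      using that tensor_map_class[OF that(1,1) N]
      by (auto simp: LN.carrier_tensor prod.map_id0 id_def[symmetric])
  qed
  have "module_cone A parallel_pair ?TF ?T\<phi> Q q"
    unfolding module_cone_def
  proof (intro conjI ballI)
    show "semimodule A Q"
      unfolding Q_def by (rule equaliser_semimodule[OF MN.tensor_semimodule hN kN])
  next
    fix j assume "j \<in> objs parallel_pair"
    then show "q j \<in> semimodule_hom A Q (tensor A (?F j) N)"
      using hN by (auto simp: q_def Q_def parallel_pair_def semimodule_hom_def)
  next
    fix e x assume "e \<in> arrs parallel_pair" "x \<in> carrier Q"
    then show "?T\<phi> e (q (src parallel_pair e) x) = q (tgt parallel_pair e) x"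
      using id_tensor[OF M] id_tensor[OF M'] semimodule_homD(1)[OF hN] semimodule_homD(1)[OF kN]
      by (auto simp: q_def Q_def parallel_pair_def)
  qed
  with limit obtain u where u: "u \<in> semimodule_hom A Q (tensor A E N)"
    and uq: "\<And>j x. \<lbrakk>j \<in> objs parallel_pair; x \<in> carrier Q\<rbrakk> \<Longrightarrow>
      tensor_map A (?F j) N (if j = 0 then (\<lambda>x. x) else h) (u x) = q j x"
    unfolding module_limit_cone_def by meson
  have sQ: "tensor_class A M N s \<in> carrier Q"
    using s eq MN'.tensor_class_eq_iff MN'.tensor_cong_formal_sum[OF eq]
    by (auto simp: Q_def MN.carrier_tensor tensor_map_class[OF M M' N h] tensor_map_class[OF M M' N k])
  then obtain t where t: "EN.formal_sum t" "u (tensor_class A M N s) = tensor_class A E N t"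
    using semimodule_homD(1)[OF u sQ] by (auto simp: EN.carrier_tensor)
  have "tensor_class A M N (image_mset (map_prod (\<lambda>x. x) id) t) = tensor_class A M N s"
    using uq[of 0, OF _ sQ] t tensor_map_class[OF E M N incl t(1)] by (simp add: parallel_pair_def q_def)
  then have "tensor_class A M N t = tensor_class A M N s"
    by (simp add: prod.map_id0 id_def[symmetric])
  moreover have "set_mset t \<subseteq> {x \<in> carrier M. h x = k x} \<times> carrier N"
    using t(1) by (simp add: E_def)
  moreover from this have "MN.formal_sum t"
    by auto
  ultimately show ?thesis
    using MN.tensor_class_eq_iff by blast
qed

section \<open>Epimorphisms and the tensor square\<close>

text \<open>On representatives, the multiplication of the semiring \<open>B \<otimes>\<^sub>A B\<close>.\<close>

definition formal_mult ::
  "'b ring \<Rightarrow> ('b \<times> 'b) multiset \<Rightarrow> ('b \<times> 'b) multiset \<Rightarrow> ('b \<times> 'b) multiset" where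
  "formal_mult B s t =
     (\<Sum>z\<in>#s. image_mset (\<lambda>w. (fst z \<otimes>\<^bsub>B\<^esub> fst w, snd z \<otimes>\<^bsub>B\<^esub> snd w)) t)"

lemma formal_mult_simps [simp]:
  "formal_mult B {#} t = {#}"
  "formal_mult B s {#} = {#}"
  "formal_mult B (s + s') t = formal_mult B s t + formal_mult B s' t"
  "formal_mult B s (t + t') = formal_mult B s t + formal_mult B s t'"
  "formal_mult B {#z#} {#w#} = {#(fst z \<otimes>\<^bsub>B\<^esub> fst w, snd z \<otimes>\<^bsub>B\<^esub> snd w)#}"
  by (simp_all add: formal_mult_def sum_mset.distrib)

lemma formal_mult_add_mset:
  "formal_mult B (add_mset z s) t = formal_mult B {#z#} t + formal_mult B s t"
  "formal_mult B s (add_mset w t) = formal_mult B s {#w#} + formal_mult B s t"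
  using formal_mult_simps(3)[of B "{#z#}" s t] formal_mult_simps(4)[of B s "{#w#}" t]
  by simp_all

lemma set_formal_mult:
  assumes "csemiring B" "set_mset s \<subseteq> carrier B \<times> carrier B" "set_mset t \<subseteq> carrier B \<times> carrier B"
  shows "set_mset (formal_mult B s t) \<subseteq> carrier B \<times> carrier B"
proof -
  interpret csemiring B by fact
  show ?thesis
    using assms(2,3) by (fastforce simp: formal_mult_def)
qed

lemma formal_mult_comm:
  assumes "csemiring B" "set_mset s \<subseteq> carrier B \<times> carrier B" "set_mset t \<subseteq> carrier B \<times> carrier B"
  shows "formal_mult B s t = formal_mult B t s"
proof -
  interpret csemiring B by fact
  have single: "formal_mult B {#z#} t = formal_mult B t {#z#}" if "z \<in> carrier B \<times> carrier B" for z
    using assms(3)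
  proof (induction t)
    case (add w t)
    then have "formal_mult B {#z#} {#w#} = formal_mult B {#w#} {#z#}"
      using that by (auto simp: m_comm)
    then show ?case
      using add by (simp add: formal_mult_add_mset(1)[of B w t] formal_mult_add_mset(2)[of B _ w t]
        formal_mult_add_mset(1)[of B _ "formal_mult B {#z#} t"])
  qed simp
  show ?thesis
    using assms(2)
  proof (induction s)
    case (add z s)
    then show ?case
      using single[of z] by (simp add: formal_mult_add_mset(1)[of B z s] formal_mult_add_mset(2)[of B _ z s])
  qed simp
qed

lemma formal_mult_assoc:
  assumes "csemiring B" "set_mset s \<subseteq> carrier B \<times> carrier B" "set_mset t \<subseteq> carrier B \<times> carrier B"
    "set_mset u \<subseteq> carrier B \<times> carrier B"
  shows "formal_mult B (formal_mult B s t) u = formal_mult B s (formal_mult B t u)"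
proof -
  interpret csemiring B by fact
  have 1: "formal_mult B (formal_mult B {#z#} {#w#}) u = formal_mult B {#z#} (formal_mult B {#w#} u)"
    if "z \<in> carrier B \<times> carrier B" "w \<in> carrier B \<times> carrier B" for z w
    using assms(4)
  proof (induction u)
    case (add v u)
    then have "formal_mult B (formal_mult B {#z#} {#w#}) {#v#} =
        formal_mult B {#z#} (formal_mult B {#w#} {#v#})"
      using that by (auto simp: m_assoc)
    then show ?case
      using add by (simp add: formal_mult_add_mset(2)[of B _ v u]
        formal_mult_add_mset(2)[of B "{#z#}" _ "formal_mult B {#w#} u"])
  qed simp
  have 2: "formal_mult B (formal_mult B {#z#} t) u = formal_mult B {#z#} (formal_mult B t u)"
    if "z \<in> carrier B \<times> carrier B" for z
    using assms(3)
  proof (induction t)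
    case (add w t)
    then show ?case
      using 1[OF that, of w]
      by (simp add: formal_mult_add_mset(1)[of B w t] formal_mult_add_mset(2)[of B _ w t]
        formal_mult_add_mset(1)[of B _ "formal_mult B {#z#} t"])
  qed simp
  show ?thesis
    using assms(2)
  proof (induction s)
    case (add z s)
    then show ?case
      using 2[of z] by (simp add: formal_mult_add_mset(1)[of B z s])
  qed simp
qed

text \<open>
  The congruence need only be multiplied with single pairs, by bilinearity; multiplication with a pair
  maps each defining relation of the tensor product to a relation of the same kind.
\<close>

lemma tensor_cong_formal_mult:
  assumes A: "csemiring A" and B: "csemiring B" and f: "f \<in> csemiring_hom A B"
    and cong: "tensor_cong A (module_via f B) (module_via f B) s s'"
    and t: "set_mset t \<subseteq> carrier B \<times> carrier B"
  shows "tensor_cong A (module_via f B) (module_via f B) (formal_mult B s t) (formal_mult B s' t)"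
proof -
  interpret B: csemiring B by fact
  let ?N = "module_via f B"
  note [simp] = csemiring_homD[OF f]
  have extend: "tensor_cong A ?N ?N (formal_mult B l t) (formal_mult B r t)"
    if *: "\<And>x y. \<lbrakk>x \<in> carrier B; y \<in> carrier B\<rbrakk> \<Longrightarrow>
      tensor_cong A ?N ?N (formal_mult B l {#(x, y)#}) (formal_mult B r {#(x, y)#})" for l r
    using t
  proof (induction t)
    case empty
    show ?case by (auto intro: tensor_cong.refl)
  next
    case (add z t)
    then obtain x y where z: "z = (x, y)" "x \<in> carrier B" "y \<in> carrier B"
      by auto
    show ?case
      using tensor_cong.plus[OF add.IH *[OF z(2,3)]] add.prems unfolding z(1)
      by (simp add: formal_mult_add_mset(2)[of B _ "(x, y)" t] add.commute)
  qed
  show ?thesis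
    using cong
  proof (induction rule: tensor_cong.induct)
    case (refl s)
    then show ?case
      using set_formal_mult[OF B _ t] by (intro tensor_cong.refl) auto
  next
    case (add_left x x' y)
    show ?case
    proof (rule extend)
      fix u v assume "u \<in> carrier B" "v \<in> carrier B"
      then show "tensor_cong A ?N ?N (formal_mult B {#(x \<oplus>\<^bsub>?N\<^esub> x', y)#} {#(u, v)#})
          (formal_mult B {#(x, y), (x', y)#} {#(u, v)#})"
        using add_left tensor_cong.add_left[of "x \<otimes>\<^bsub>B\<^esub> u" ?N "x' \<otimes>\<^bsub>B\<^esub> u" "y \<otimes>\<^bsub>B\<^esub> v" ?N A]
        by (simp add: B.l_distr formal_mult_add_mset(1)[of B _ "{#(x, y)#}"]
            formal_mult_add_mset(1)[of B _ "{#(x', y)#}"] add_mset_commute)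
    qed
  next
    case (add_right x y y')
    show ?case
    proof (rule extend)
      fix u v assume "u \<in> carrier B" "v \<in> carrier B"
      then show "tensor_cong A ?N ?N (formal_mult B {#(x, y \<oplus>\<^bsub>?N\<^esub> y')#} {#(u, v)#})
          (formal_mult B {#(x, y), (x, y')#} {#(u, v)#})"
        using add_right tensor_cong.add_right[of "x \<otimes>\<^bsub>B\<^esub> u" ?N "y \<otimes>\<^bsub>B\<^esub> v" ?N "y' \<otimes>\<^bsub>B\<^esub> v" A]
        by (simp add: B.l_distr formal_mult_add_mset(1)[of B _ "{#(x, y)#}"]
            formal_mult_add_mset(1)[of B _ "{#(x, y')#}"] add_mset_commute)
    qed
  next
    case (zero_left y)
    then show ?case
      using tensor_cong.zero_left[of _ ?N A ?N] by (intro extend) simp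
  next
    case (zero_right x)
    then show ?case
      using tensor_cong.zero_right[of _ ?N A ?N] by (intro extend) simp
  next
    case (smult a x y)
    show ?case
    proof (rule extend)
      fix u v assume "u \<in> carrier B" "v \<in> carrier B"
      then show "tensor_cong A ?N ?N (formal_mult B {#(a \<odot>\<^bsub>?N\<^esub> x, y)#} {#(u, v)#})
          (formal_mult B {#(x, a \<odot>\<^bsub>?N\<^esub> y)#} {#(u, v)#})"
        using smult tensor_cong.smult[of a A "x \<otimes>\<^bsub>B\<^esub> u" ?N "y \<otimes>\<^bsub>B\<^esub> v" ?N]
        by (simp add: B.m_assoc)
    qed
  qed (auto intro: tensor_cong.intros)
qed

text \<open>
  Since \<open>f a \<otimes> 1 = 1 \<otimes> f a\<close>, the two coprojections of the semiring \<open>B \<otimes>\<^sub>A B\<close> agree on \<open>A\<close>, so an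
  epimorphism forces them to be equal.
\<close>

lemma epi_tensor_square:
  fixes A B :: "('u::infinite) ring"
  assumes A: "csemiring A" and B: "csemiring B" and epi: "csemiring_epi A B f"
    and b: "b \<in> carrier B"
  shows "tensor_cong A (module_via f B) (module_via f B) {#(b, \<one>\<^bsub>B\<^esub>)#} {#(\<one>\<^bsub>B\<^esub>, b)#}"
proof -
  have f: "f \<in> csemiring_hom A B" using epi by (simp add: csemiring_epi_def)
  interpret B: csemiring B by fact
  let ?N = "module_via f B"
  interpret N: semimodule_pair A ?N ?N
    using semimodule_via[OF A B f] by (simp add: semimodule_pair_def)
  define X where "X = {s. set_mset s \<subseteq> carrier B \<times> carrier B}"
  obtain e :: "('u \<times> 'u) multiset \<Rightarrow> 'u" where e: "inj e"
    using ex_inj_multiset_pairs by blast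
  have refl: "tensor_cong A ?N ?N s s" if "s \<in> X" for s
    using that by (intro tensor_cong.refl) (auto simp: X_def)
  have "\<exists>(C :: 'u ring) cl. csemiring C \<and> carrier C = cl ` X \<and>
    (\<forall>x\<in>X. \<forall>y\<in>X. cl x = cl y \<longleftrightarrow> tensor_cong A ?N ?N x y) \<and>
    (\<forall>x\<in>X. \<forall>y\<in>X. cl (x + y) = cl x \<oplus>\<^bsub>C\<^esub> cl y) \<and>
    (\<forall>x\<in>X. \<forall>y\<in>X. cl (formal_mult B x y) = cl x \<otimes>\<^bsub>C\<^esub> cl y) \<and>
    cl {#} = \<zero>\<^bsub>C\<^esub> \<and> cl {#(\<one>\<^bsub>B\<^esub>, \<one>\<^bsub>B\<^esub>)#} = \<one>\<^bsub>C\<^esub>"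
  proof (rule ex_quotient_csemiring)
    show "inj_on e X" using e by (rule inj_on_subset) simp
  next
    fix s s' t assume "s \<in> X" "s' \<in> X" "t \<in> X" "tensor_cong A ?N ?N s s'"
    then show "tensor_cong A ?N ?N (s + t) (s' + t)"
      "tensor_cong A ?N ?N (formal_mult B s t) (formal_mult B s' t)"
      using tensor_cong_formal_mult[OF A B f] refl by (auto simp: X_def intro: tensor_cong.plus)
  next
    fix s t assume "s \<in> X" "t \<in> X"
    then show fm: "formal_mult B s t \<in> X" using set_formal_mult[OF B] by (auto simp: X_def)
    show "tensor_cong A ?N ?N (formal_mult B s t) (formal_mult B t s)"
      using refl[OF fm] formal_mult_comm[OF B, of s t] \<open>s \<in> X\<close> \<open>t \<in> X\<close> by (simp add: X_def)
    show "tensor_cong A ?N ?N (s + t) (t + s)"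
      using refl[of "s + t"] \<open>s \<in> X\<close> \<open>t \<in> X\<close> by (simp add: X_def add.commute)
  next
    fix s t u assume stu: "s \<in> X" "t \<in> X" "u \<in> X"
    then have "formal_mult B (formal_mult B s t) u \<in> X" using set_formal_mult[OF B] by (auto simp: X_def)
    then show "tensor_cong A ?N ?N (formal_mult B (formal_mult B s t) u)
        (formal_mult B s (formal_mult B t u))"
      using refl formal_mult_assoc[OF B, of s t u] stu by (auto simp: X_def)
    have "formal_mult B (s + t) u \<in> X" using stu set_formal_mult[OF B, of "s + t" u] by (auto simp: X_def)
    then show "tensor_cong A ?N ?N (formal_mult B (s + t) u) (formal_mult B s u + formal_mult B t u)"
      using refl by simp
    show "tensor_cong A ?N ?N (s + t + u) (s + (t + u))"
      using refl[of "s + t + u"] stu by (simp add: X_def add.assoc)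
  next
    fix s assume s: "s \<in> X"
    have "image_mset (\<lambda>w. (\<one>\<^bsub>B\<^esub> \<otimes>\<^bsub>B\<^esub> fst w, \<one>\<^bsub>B\<^esub> \<otimes>\<^bsub>B\<^esub> snd w)) s = image_mset id s"
      by (rule image_mset_cong) (use s in \<open>auto simp: X_def\<close>)
    then have "formal_mult B {#(\<one>\<^bsub>B\<^esub>, \<one>\<^bsub>B\<^esub>)#} s = s"
      by (simp add: formal_mult_def)
    then show "tensor_cong A ?N ?N (formal_mult B {#(\<one>\<^bsub>B\<^esub>, \<one>\<^bsub>B\<^esub>)#} s) s"
      using refl[OF s] by simp
  qed (auto simp: X_def refl intro: tensor_cong.sym tensor_cong.trans tensor_cong.refl)
  then obtain C :: "'u ring" and cl where C: "csemiring C" "carrier C = cl ` X"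
    and cl: "\<And>x y. \<lbrakk>x \<in> X; y \<in> X\<rbrakk> \<Longrightarrow> cl x = cl y \<longleftrightarrow> tensor_cong A ?N ?N x y"
    and cl_add: "\<And>x y. \<lbrakk>x \<in> X; y \<in> X\<rbrakk> \<Longrightarrow> cl x \<oplus>\<^bsub>C\<^esub> cl y = cl (x + y)"
    and cl_mult: "\<And>x y. \<lbrakk>x \<in> X; y \<in> X\<rbrakk> \<Longrightarrow> cl x \<otimes>\<^bsub>C\<^esub> cl y = cl (formal_mult B x y)"
    and cl_const: "cl {#} = \<zero>\<^bsub>C\<^esub>" "cl {#(\<one>\<^bsub>B\<^esub>, \<one>\<^bsub>B\<^esub>)#} = \<one>\<^bsub>C\<^esub>"
    by metis
  have X: "{#(x, y)#} \<in> X \<longleftrightarrow> x \<in> carrier B \<and> y \<in> carrier B"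
    "{#(x, y), (x', y')#} \<in> X \<longleftrightarrow>
      x \<in> carrier B \<and> y \<in> carrier B \<and> x' \<in> carrier B \<and> y' \<in> carrier B" "{#} \<in> X" for x y x' y'
    by (auto simp: X_def)
  have left: "(\<lambda>x. cl {#(x, \<one>\<^bsub>B\<^esub>)#}) \<in> csemiring_hom B C"
  proof (rule csemiring_homI)
    fix x y assume "x \<in> carrier B" "y \<in> carrier B"
    then show "cl {#(x \<oplus>\<^bsub>B\<^esub> y, \<one>\<^bsub>B\<^esub>)#} = cl {#(x, \<one>\<^bsub>B\<^esub>)#} \<oplus>\<^bsub>C\<^esub> cl {#(y, \<one>\<^bsub>B\<^esub>)#}"
      using tensor_cong.add_left[of x ?N y "\<one>\<^bsub>B\<^esub>" ?N A]
      by (simp add: cl_add cl X add_mset_commute)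
  next
    show "cl {#(\<zero>\<^bsub>B\<^esub>, \<one>\<^bsub>B\<^esub>)#} = \<zero>\<^bsub>C\<^esub>"
      using tensor_cong.zero_left[of "\<one>\<^bsub>B\<^esub>" ?N A ?N]
      by (simp add: X cl_const(1)[symmetric] cl)
  qed (auto simp: cl_mult cl_const X C)
  have right: "(\<lambda>x. cl {#(\<one>\<^bsub>B\<^esub>, x)#}) \<in> csemiring_hom B C"
  proof (rule csemiring_homI)
    fix x y assume "x \<in> carrier B" "y \<in> carrier B"
    then show "cl {#(\<one>\<^bsub>B\<^esub>, x \<oplus>\<^bsub>B\<^esub> y)#} = cl {#(\<one>\<^bsub>B\<^esub>, x)#} \<oplus>\<^bsub>C\<^esub> cl {#(\<one>\<^bsub>B\<^esub>, y)#}"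
      using tensor_cong.add_right[of "\<one>\<^bsub>B\<^esub>" ?N x ?N y A]
      by (simp add: cl_add cl X add_mset_commute)
  next
    show "cl {#(\<one>\<^bsub>B\<^esub>, \<zero>\<^bsub>B\<^esub>)#} = \<zero>\<^bsub>C\<^esub>"
      using tensor_cong.zero_right[of "\<one>\<^bsub>B\<^esub>" ?N A ?N]
      by (simp add: X cl_const(1)[symmetric] cl)
  qed (auto simp: cl_mult cl_const X C)
  have "cl {#(f a, \<one>\<^bsub>B\<^esub>)#} = cl {#(\<one>\<^bsub>B\<^esub>, f a)#}" if "a \<in> carrier A" for a
    using tensor_cong.smult[of a A "\<one>\<^bsub>B\<^esub>" ?N "\<one>\<^bsub>B\<^esub>" ?N] that csemiring_homD(1)[OF f]
    by (simp add: cl X)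
  then have "cl {#(b, \<one>\<^bsub>B\<^esub>)#} = cl {#(\<one>\<^bsub>B\<^esub>, b)#}"
    using epi C(1) left right b unfolding csemiring_epi_def by blast
  then show ?thesis
    using b by (simp add: cl X)
qed

section \<open>Denominators and annihilators outside a prime\<close>

text \<open>
  If \<open>t\<close> is a preimage in \<open>E \<otimes> B\<close> of an element of \<open>M \<otimes> B\<close> which \<open>\<phi>\<close> contracts to \<open>\<one>\<close>, then \<open>\<one>\<close> is a
  linear combination of the \<open>\<phi> e\<close> for the \<open>e \<in> E\<close> occurring in \<open>t\<close>, so one of these avoids \<open>q\<close>.
\<close>

lemma flat_solution_outside_prime:
  fixes A B :: "('u::infinite) ring" and M M' :: "('u, 'u) module"
  assumes A: "csemiring A" and B: "csemiring B" and flat: "flat_hom A B f"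
    and M: "semimodule A M" and M': "semimodule A M'"
    and h: "h \<in> semimodule_hom A M M'" and k: "k \<in> semimodule_hom A M M'"
    and \<phi>: "\<phi> \<in> semimodule_hom A M (module_via f B)"
    and s: "set_mset s \<subseteq> carrier M \<times> carrier B"
    and eq: "tensor_cong A M' (module_via f B)
      (image_mset (map_prod h id) s) (image_mset (map_prod k id) s)"
    and one: "contract B \<phi> s = \<one>\<^bsub>B\<^esub>"
    and q: "csemiring_prime B q"
  shows "\<exists>e\<in>carrier M. h e = k e \<and> \<phi> e \<notin> q"
proof (rule ccontr)
  assume contra: "\<not> ?thesis"
  interpret B: csemiring B by fact
  have f: "f \<in> csemiring_hom A B" and fm: "flat_module A (module_via f B)"
    using flat by (auto simp: flat_hom_def)
  note qD = csemiring_primeD[OF q]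
  obtain t where t: "set_mset t \<subseteq> {x \<in> carrier M. h x = k x} \<times> carrier B"
    and ts: "tensor_cong A M (module_via f B) t s"
    using flat_equaliser[OF fm M M' h k, of s] s eq unfolding module_via_simps by blast
  have "set_mset t \<subseteq> {x \<in> carrier M. \<phi> x \<in> q} \<times> carrier B"
    using t contra by blast
  then have "contract B \<phi> t \<in> q"
  proof (induction t)
    case empty
    then show ?case using qD by (simp add: contract_def)
  next
    case (add z t)
    obtain m x where z: "z = (m, x)" "m \<in> carrier M" "\<phi> m \<in> q" "x \<in> carrier B"
      using add.prems by auto
    have "set_mset (image_mset (\<lambda>(m, x). \<phi> m \<otimes>\<^bsub>B\<^esub> x) t) \<subseteq> carrier B"
      using add.prems qD(1) by auto
    moreover have "\<phi> m \<otimes>\<^bsub>B\<^esub> x \<in> q"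
      using z qD by (subst B.m_comm) auto
    moreover have "contract B \<phi> t \<in> q"
      using add by simp
    ultimately show ?case
      using z qD by (auto simp: contract_def)
  qed
  then show False
    using contract_cong[OF A B f M \<phi> ts] one qD by simp
qed

text \<open>
  The module \<open>A \<times> A\<close>. Pairs are encoded by the injective function \<open>pr\<close>, because flatness speaks of
  diagrams of modules carried by the type \<open>'u\<close>; \<open>p1\<close> and \<open>p2\<close> are the projections.
\<close>

definition square_module :: "('u \<Rightarrow> 'u \<Rightarrow> 'u) \<Rightarrow> 'u ring \<Rightarrow> ('u, 'u) module" where
  "square_module pr A = (let p1 = (\<lambda>z. THE a. \<exists>c. z = pr a c); p2 = (\<lambda>z. THE c. \<exists>a. z = pr a c) in
     \<lparr>carrier = (\<lambda>(a, c). pr a c) ` (carrier A \<times> carrier A),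
      monoid.mult = undefined, one = undefined, zero = pr \<zero>\<^bsub>A\<^esub> \<zero>\<^bsub>A\<^esub>,
      add = (\<lambda>z w. pr (p1 z \<oplus>\<^bsub>A\<^esub> p1 w) (p2 z \<oplus>\<^bsub>A\<^esub> p2 w)),
      smult = (\<lambda>x z. pr (x \<otimes>\<^bsub>A\<^esub> p1 z) (x \<otimes>\<^bsub>A\<^esub> p2 z))\<rparr>)"

text \<open>
  The pairs \<open>(a, c)\<close> with \<open>f a b = f c\<close> form the equaliser of two linear maps \<open>A \<times> A \<rightarrow> B\<close>. The
  element \<open>s = (1, 0) \<otimes> 1 + (0, 1) \<otimes> b\<close> of \<open>(A \<times> A) \<otimes> B\<close> equalises the tensored maps, since this
  condition reads \<open>b \<otimes> 1 = 1 \<otimes> b\<close> in \<open>B \<otimes> B\<close>. The first projection contracts \<open>s\<close> to \<open>1\<close>.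
\<close>

lemma flat_epi_denominator:
  fixes A B :: "('u::infinite) ring"
  assumes A: "csemiring A" and B: "csemiring B" and flat: "flat_hom A B f"
    and epi: "csemiring_epi A B f" and b: "b \<in> carrier B" and q: "csemiring_prime B q"
  shows "\<exists>a\<in>carrier A. \<exists>c\<in>carrier A. f a \<notin> q \<and> f a \<otimes>\<^bsub>B\<^esub> b = f c"
proof -
  interpret A: csemiring A by fact
  interpret B: csemiring B by fact
  have f: "f \<in> csemiring_hom A B" using flat by (simp add: flat_hom_def)
  note [simp] = csemiring_homD[OF f]
  let ?N = "module_via f B"
  obtain pr :: "'u \<Rightarrow> 'u \<Rightarrow> 'u" where pr: "\<And>a b c d. pr a b = pr c d \<longleftrightarrow> a = c \<and> b = d"
    using ex_pair_encoding by metis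
  define p1 where "p1 z = (THE a. \<exists>c. z = pr a c)" for z
  define p2 where "p2 z = (THE c. \<exists>a. z = pr a c)" for z
  have p [simp]: "p1 (pr a c) = a" "p2 (pr a c) = c" for a c
    by (auto simp: p1_def p2_def pr)
  define M where "M = square_module pr A"
  have M_simps: "carrier M = (\<lambda>(a, c). pr a c) ` (carrier A \<times> carrier A)" "\<zero>\<^bsub>M\<^esub> = pr \<zero>\<^bsub>A\<^esub> \<zero>\<^bsub>A\<^esub>"
    "z \<oplus>\<^bsub>M\<^esub> w = pr (p1 z \<oplus>\<^bsub>A\<^esub> p1 w) (p2 z \<oplus>\<^bsub>A\<^esub> p2 w)"
    "x \<odot>\<^bsub>M\<^esub> z = pr (x \<otimes>\<^bsub>A\<^esub> p1 z) (x \<otimes>\<^bsub>A\<^esub> p2 z)" for x z w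
    by (simp_all add: M_def square_module_def p1_def p2_def)
  have M_mem: "pr a c \<in> carrier M \<longleftrightarrow> a \<in> carrier A \<and> c \<in> carrier A" for a c
    by (auto simp: M_simps pr)
  have M_cases: thesis
    if "z \<in> carrier M" "\<And>a c. \<lbrakk>z = pr a c; a \<in> carrier A; c \<in> carrier A\<rbrakk> \<Longrightarrow> thesis" for z thesis
    using that by (auto simp: M_simps)
  have M: "semimodule A M"
    by (rule semimoduleI[OF A])
      (auto simp: M_simps(2-) M_mem A.a_ac A.m_assoc A.l_distr A.r_distr elim!: M_cases)
  have N: "semimodule A ?N"
    by (rule semimodule_via[OF A B f])
  interpret NN: semimodule_pair A ?N ?N
    using N by (simp add: semimodule_pair_def)
  have first: "(\<lambda>z. f (p1 z)) \<in> semimodule_hom A M ?N"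
    by (rule semimodule_homI) (auto simp: M_simps)
  have scaled: "(\<lambda>z. f (p1 z) \<otimes>\<^bsub>B\<^esub> b) \<in> semimodule_hom A M ?N"
    using b by (intro semimodule_homI) (auto simp: M_simps B.l_distr B.m_assoc)
  have second: "(\<lambda>z. f (p2 z)) \<in> semimodule_hom A M ?N"
    by (rule semimodule_homI) (auto simp: M_simps)
  define s where "s = {#(pr \<one>\<^bsub>A\<^esub> \<zero>\<^bsub>A\<^esub>, \<one>\<^bsub>B\<^esub>), (pr \<zero>\<^bsub>A\<^esub> \<one>\<^bsub>A\<^esub>, b)#}"
  have "tensor_cong A ?N ?N ({#(b, \<one>\<^bsub>B\<^esub>)#} + {#(\<zero>\<^bsub>B\<^esub>, b)#}) ({#(\<one>\<^bsub>B\<^esub>, b)#} + {#(\<zero>\<^bsub>B\<^esub>, \<one>\<^bsub>B\<^esub>)#})"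
  proof (rule tensor_cong.plus)
    show "tensor_cong A ?N ?N {#(b, \<one>\<^bsub>B\<^esub>)#} {#(\<one>\<^bsub>B\<^esub>, b)#}"
      by (rule epi_tensor_square[OF A B epi b])
    show "tensor_cong A ?N ?N {#(\<zero>\<^bsub>B\<^esub>, b)#} {#(\<zero>\<^bsub>B\<^esub>, \<one>\<^bsub>B\<^esub>)#}"
      using tensor_cong.zero_left[of b ?N A ?N] tensor_cong.zero_left[of "\<one>\<^bsub>B\<^esub>" ?N A ?N] b
      by (auto intro: tensor_cong.trans tensor_cong.sym)
  qed
  then have "tensor_cong A ?N ?N (image_mset (map_prod (\<lambda>z. f (p1 z) \<otimes>\<^bsub>B\<^esub> b) id) s)
      (image_mset (map_prod (\<lambda>z. f (p2 z)) id) s)"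
    using b by (simp add: s_def add_mset_commute)
  moreover have "contract B (\<lambda>z. f (p1 z)) s = \<one>\<^bsub>B\<^esub>"
    using b by (simp add: s_def contract_def)
  moreover have "set_mset s \<subseteq> carrier M \<times> carrier B"
    using b by (auto simp: s_def M_simps)
  ultimately have "\<exists>e\<in>carrier M. f (p1 e) \<otimes>\<^bsub>B\<^esub> b = f (p2 e) \<and> f (p1 e) \<notin> q"
    by (intro flat_solution_outside_prime[OF A B flat M N scaled second first _ _ _ q])
  then show ?thesis
    by (auto simp: M_simps)
qed

text \<open>
  The elements \<open>a\<close> with \<open>a s = a t\<close> form the equaliser of two linear maps \<open>A \<rightarrow> A\<close>, which agree on
  \<open>1 \<otimes> 1\<close> after tensoring: \<open>s \<otimes> 1 = 1 \<otimes> f s = 1 \<otimes> f t = t \<otimes> 1\<close>.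
\<close>

lemma flat_annihilator:
  fixes A B :: "('u::infinite) ring"
  assumes A: "csemiring A" and B: "csemiring B" and flat: "flat_hom A B f"
    and st: "s \<in> carrier A" "t \<in> carrier A" "f s = f t" and q: "csemiring_prime B q"
  shows "\<exists>a\<in>carrier A. f a \<notin> q \<and> a \<otimes>\<^bsub>A\<^esub> s = a \<otimes>\<^bsub>A\<^esub> t"
proof -
  interpret A: csemiring A by fact
  interpret B: csemiring B by fact
  have f: "f \<in> csemiring_hom A B" using flat by (simp add: flat_hom_def)
  note [simp] = csemiring_homD[OF f]
  let ?N = "module_via f B"
  define M where "M = module_via (\<lambda>x. x) A"
  have "(\<lambda>x. x) \<in> csemiring_hom A A" by (rule csemiring_homI) auto
  then have M: "semimodule A M" unfolding M_def by (rule semimodule_via[OF A A])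
  have mult: "(\<lambda>a. a \<otimes>\<^bsub>A\<^esub> x) \<in> semimodule_hom A M M" if "x \<in> carrier A" for x
    using that by (intro semimodule_homI) (auto simp: M_def A.l_distr A.m_assoc)
  have fM: "f \<in> semimodule_hom A M ?N"
    by (rule semimodule_homI) (auto simp: M_def)
  define z where "z = {#(\<one>\<^bsub>A\<^esub>, \<one>\<^bsub>B\<^esub>)#}"
  have move: "tensor_cong A M ?N {#(x, \<one>\<^bsub>B\<^esub>)#} {#(\<one>\<^bsub>A\<^esub>, f x)#}" if "x \<in> carrier A" for x
    using tensor_cong.smult[of x A "\<one>\<^bsub>A\<^esub>" M "\<one>\<^bsub>B\<^esub>" ?N] that by (simp add: M_def)
  have "tensor_cong A M ?N {#(s, \<one>\<^bsub>B\<^esub>)#} {#(t, \<one>\<^bsub>B\<^esub>)#}"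
    using move[OF st(1)] move[OF st(2)] st(3) by (auto intro: tensor_cong.trans tensor_cong.sym)
  then have "tensor_cong A M ?N (image_mset (map_prod (\<lambda>a. a \<otimes>\<^bsub>A\<^esub> s) id) z)
      (image_mset (map_prod (\<lambda>a. a \<otimes>\<^bsub>A\<^esub> t) id) z)"
    using st by (simp add: z_def)
  moreover have "contract B f z = \<one>\<^bsub>B\<^esub>"
    by (simp add: z_def contract_def)
  moreover have "set_mset z \<subseteq> carrier M \<times> carrier B"
    by (auto simp: z_def M_def)
  ultimately have "\<exists>e\<in>carrier M. e \<otimes>\<^bsub>A\<^esub> s = e \<otimes>\<^bsub>A\<^esub> t \<and> f e \<notin> q"
    by (intro flat_solution_outside_prime[OF A B flat M M mult[OF st(1)] mult[OF st(2)] fM _ _ _ q])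
  then show ?thesis
    by (auto simp: M_def)
qed

section \<open>Localisation at a prime\<close>

text \<open>
  The ideal \<open>m\<close> consists of the fractions with numerator in \<open>p\<close>. It does not depend on the
  representation of the fraction, since the equality \<open>r x t = r y s\<close> of fractions \<open>x / s\<close> and \<open>y / t\<close> has
  \<open>r\<close>, \<open>s\<close> and \<open>t\<close> outside the prime \<open>p\<close>.
\<close>

lemma ex_localisation:
  fixes A :: "('u::infinite) ring" (structure)
  assumes A: "csemiring A" and p: "csemiring_prime A p"
  shows "\<exists>(C :: 'u ring) c m. csemiring C \<and> c \<in> csemiring_hom A C \<and>
    csemiring_prime C m \<and> Spec_map A c m = p \<and>
    (\<forall>s\<in>carrier A - p. \<exists>v\<in>carrier C. c s \<otimes>\<^bsub>C\<^esub> v = \<one>\<^bsub>C\<^esub>)"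
proof -
  interpret csemiring A by fact
  note pD = csemiring_primeD[OF p]
  define S where "S = carrier A - p"
  have S [simp]: "s \<in> S \<Longrightarrow> s \<in> carrier A" "\<one> \<in> S" "\<lbrakk>s \<in> S; t \<in> S\<rbrakk> \<Longrightarrow> s \<otimes> t \<in> S" for s t
    using pD by (auto simp: S_def)
  define X where "X = carrier A \<times> S"
  define eq where "eq v w \<longleftrightarrow> (\<exists>r\<in>S. r \<otimes> (fst v \<otimes> snd w) = r \<otimes> (fst w \<otimes> snd v))" for v w
  define pl where "pl v w = (fst v \<otimes> snd w \<oplus> fst w \<otimes> snd v, snd v \<otimes> snd w)" for v w
  define ti where "ti v w = (fst v \<otimes> fst w, snd v \<otimes> snd w)" for v w
  obtain pr :: "'u \<Rightarrow> 'u \<Rightarrow> 'u" where pr: "\<And>a b c d. pr a b = pr c d \<longleftrightarrow> a = c \<and> b = d"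
    using ex_pair_encoding by metis
  have eqI: "eq (x, s) (y, t)" if "x \<otimes> t = y \<otimes> s" for x s y t
    unfolding eq_def by (rule bexI[OF _ S(2)]) (simp add: that)
  have "\<exists>(C :: 'u ring) cl. csemiring C \<and> carrier C = cl ` X \<and>
    (\<forall>v\<in>X. \<forall>w\<in>X. cl v = cl w \<longleftrightarrow> eq v w) \<and>
    (\<forall>v\<in>X. \<forall>w\<in>X. cl (pl v w) = cl v \<oplus>\<^bsub>C\<^esub> cl w) \<and>
    (\<forall>v\<in>X. \<forall>w\<in>X. cl (ti v w) = cl v \<otimes>\<^bsub>C\<^esub> cl w) \<and>
    cl (\<zero>, \<one>) = \<zero>\<^bsub>C\<^esub> \<and> cl (\<one>, \<one>) = \<one>\<^bsub>C\<^esub>"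
  proof (rule ex_quotient_csemiring)
    show "inj_on (\<lambda>(x, s). pr x s) X"
      by (auto simp: inj_on_def pr)
  next
    fix v w z assume "v \<in> X" "w \<in> X" "z \<in> X" "eq v w" "eq w z"
    then obtain x s y t u k r r' where *: "v = (x, s)" "w = (y, t)" "z = (u, k)"
      "x \<in> carrier A" "y \<in> carrier A" "u \<in> carrier A" "s \<in> S" "t \<in> S" "k \<in> S" "r \<in> S" "r' \<in> S"
      and r: "r \<otimes> (x \<otimes> t) = r \<otimes> (y \<otimes> s)" and r': "r' \<otimes> (y \<otimes> k) = r' \<otimes> (u \<otimes> t)"
      by (auto simp: X_def eq_def)
    have "(r \<otimes> r' \<otimes> t) \<otimes> (x \<otimes> k) = (r' \<otimes> k) \<otimes> (r \<otimes> (x \<otimes> t))"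
      using * by (simp add: m_ac)
    also have "\<dots> = (r \<otimes> s) \<otimes> (r' \<otimes> (y \<otimes> k))"
      unfolding r using * by (simp add: m_ac)
    also have "\<dots> = (r \<otimes> r' \<otimes> t) \<otimes> (u \<otimes> s)"
      unfolding r' using * by (simp add: m_ac)
    finally show "eq v z"
      using * by (auto simp: eq_def intro!: bexI[of _ "r \<otimes> r' \<otimes> t"])
  next
    fix v v' w assume "v \<in> X" "v' \<in> X" "w \<in> X" "eq v v'"
    then obtain x s x' s' y t r where *: "v = (x, s)" "v' = (x', s')" "w = (y, t)"
      "x \<in> carrier A" "x' \<in> carrier A" "y \<in> carrier A" "s \<in> S" "s' \<in> S" "t \<in> S" "r \<in> S"
      and r: "r \<otimes> (x \<otimes> s') = r \<otimes> (x' \<otimes> s)"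
      by (auto simp: X_def eq_def)
    have "r \<otimes> ((x \<otimes> t \<oplus> y \<otimes> s) \<otimes> (s' \<otimes> t)) = (r \<otimes> (x \<otimes> s')) \<otimes> (t \<otimes> t) \<oplus> r \<otimes> (y \<otimes> s \<otimes> s' \<otimes> t)"
      using * by (simp add: l_distr r_distr m_ac)
    also have "\<dots> = r \<otimes> ((x' \<otimes> t \<oplus> y \<otimes> s') \<otimes> (s \<otimes> t))"
      unfolding r using * by (simp add: l_distr r_distr m_ac)
    finally show "eq (pl v w) (pl v' w)"
      using * by (auto simp: eq_def pl_def intro!: bexI[of _ r])
    have "r \<otimes> ((x \<otimes> y) \<otimes> (s' \<otimes> t)) = (r \<otimes> (x \<otimes> s')) \<otimes> (y \<otimes> t)"
      using * by (simp add: m_ac)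
    also have "\<dots> = r \<otimes> ((x' \<otimes> y) \<otimes> (s \<otimes> t))"
      unfolding r using * by (simp add: m_ac)
    finally show "eq (ti v w) (ti v' w)"
      using * by (auto simp: eq_def ti_def intro!: bexI[of _ r])
  next
    fix v w assume "eq v w" then show "eq w v" unfolding eq_def by metis
  qed (auto simp: X_def pl_def ti_def l_distr r_distr m_ac a_ac intro!: eqI)
  then obtain C :: "'u ring" and cl where C: "csemiring C" "carrier C = cl ` X"
    and cl: "\<And>v w. \<lbrakk>v \<in> X; w \<in> X\<rbrakk> \<Longrightarrow> cl v = cl w \<longleftrightarrow> eq v w"
    and cl_add: "\<And>v w. \<lbrakk>v \<in> X; w \<in> X\<rbrakk> \<Longrightarrow> cl v \<oplus>\<^bsub>C\<^esub> cl w = cl (pl v w)"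
    and cl_mult: "\<And>v w. \<lbrakk>v \<in> X; w \<in> X\<rbrakk> \<Longrightarrow> cl v \<otimes>\<^bsub>C\<^esub> cl w = cl (ti v w)"
    and cl_const: "\<zero>\<^bsub>C\<^esub> = cl (\<zero>, \<one>)" "\<one>\<^bsub>C\<^esub> = cl (\<one>, \<one>)"
    by metis
  note prime_mult = prime_mult_iff[OF A p]
  define m where "m = cl ` (p \<times> S)"
  have mem_m: "cl (x, s) \<in> m \<longleftrightarrow> x \<in> p" if xs: "x \<in> carrier A" "s \<in> S" for x s
  proof
    assume "cl (x, s) \<in> m"
    then obtain y t where yt: "y \<in> p" "t \<in> S" "cl (x, s) = cl (y, t)"
      by (auto simp: m_def)
    moreover from this have "y \<in> carrier A" using pD by auto
    ultimately have "eq (x, s) (y, t)"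
      using cl[of "(x, s)" "(y, t)"] xs by (simp add: X_def)
    then obtain r where r: "r \<in> S" "r \<otimes> (x \<otimes> t) = r \<otimes> (y \<otimes> s)"
      by (auto simp: eq_def)
    have "r \<otimes> (y \<otimes> s) \<in> p"
      using yt \<open>y \<in> carrier A\<close> r xs by (simp add: prime_mult)
    then have "r \<otimes> (x \<otimes> t) \<in> p"
      by (simp add: r(2))
    then show "x \<in> p"
      using r(1) yt(2) xs prime_mult by (auto simp: S_def)
  qed (use xs in \<open>auto simp: m_def\<close>)
  have X: "(x, s) \<in> X \<longleftrightarrow> x \<in> carrier A \<and> s \<in> S" for x s
    by (auto simp: X_def)
  have cases: thesis
    if "z \<in> carrier C" "\<And>x s. \<lbrakk>z = cl (x, s); x \<in> carrier A; s \<in> S\<rbrakk> \<Longrightarrow> thesis" for z thesis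
    using that by (auto simp: C(2) X_def)
  have m_sub: "m \<subseteq> carrier C"
    using pD by (auto simp: m_def C(2) X_def)
  have "csemiring_prime C m"
    unfolding csemiring_prime_def csemiring_ideal_def
  proof (intro conjI ballI)
    show "m \<subseteq> carrier C" by (rule m_sub)
    show "\<zero>\<^bsub>C\<^esub> \<in> m" using mem_m[of \<zero> \<one>] pD by (simp add: cl_const)
    show "\<one>\<^bsub>C\<^esub> \<in> carrier C - m" using mem_m[of \<one> \<one>] pD by (auto simp: cl_const C(2) X_def)
  next
    fix v w assume vw: "v \<in> m" "w \<in> m"
    then have "v \<in> carrier C" "w \<in> carrier C" using m_sub by auto
    with vw show "v \<oplus>\<^bsub>C\<^esub> w \<in> m"
      by (elim cases) (simp add: cl_add X pl_def mem_m prime_mult pD)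
  next
    fix v w assume vw: "v \<in> carrier C" "w \<in> m"
    then have "w \<in> carrier C" using m_sub by auto
    with vw show "v \<otimes>\<^bsub>C\<^esub> w \<in> m"
      by (elim cases) (simp add: cl_mult X ti_def mem_m prime_mult pD)
  next
    fix v w assume "v \<in> carrier C - m" "w \<in> carrier C - m"
    then have vw: "v \<in> carrier C" "w \<in> carrier C" "v \<notin> m" "w \<notin> m" by auto
    then have "v \<otimes>\<^bsub>C\<^esub> w \<notin> m"
      by (elim cases) (simp add: cl_mult X ti_def mem_m prime_mult pD)
    moreover have "v \<otimes>\<^bsub>C\<^esub> w \<in> carrier C"
      using vw C(1) by (meson csemiring.axioms(1) semiring.axioms(2) monoid.m_closed)
    ultimately show "v \<otimes>\<^bsub>C\<^esub> w \<in> carrier C - m" by simp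
  qed
  moreover define c where "c a = cl (a, \<one>)" for a
  have "c \<in> csemiring_hom A C"
    by (rule csemiring_homI) (auto simp: c_def cl_add cl_mult cl_const C(2) pl_def ti_def X)
  moreover have "Spec_map A c m = p"
    using pD by (auto simp: Spec_map_def c_def mem_m)
  moreover have "\<exists>v\<in>carrier C. c s \<otimes>\<^bsub>C\<^esub> v = \<one>\<^bsub>C\<^esub>" if "s \<in> carrier A - p" for s
  proof -
    have s: "s \<in> S" using that by (simp add: S_def)
    then have "eq (s, s) (\<one>, \<one>)" by (intro eqI) simp
    then have "c s \<otimes>\<^bsub>C\<^esub> cl (\<one>, s) = \<one>\<^bsub>C\<^esub>"
      using s cl[of "(s, s)" "(\<one>, \<one>)"] by (simp add: c_def cl_mult cl_const X ti_def)
    moreover have "cl (\<one>, s) \<in> carrier C"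
      using s by (auto simp: C(2) X_def)
    ultimately show ?thesis by blast
  qed
  ultimately show ?thesis
    using C(1) by blast
qed

section \<open>Polynomial semirings\<close>

lemma finite_submultisets: "finite {u. u \<subseteq># m}"
proof (induction m)
  case (add x m)
  have "u \<in> {u. u \<subseteq># m} \<union> add_mset x ` {u. u \<subseteq># m}" if "u \<subseteq># add_mset x m" for u
  proof (cases "x \<in># u")
    case True
    then have "u = add_mset x (u - {#x#})" by simp
    moreover have "u - {#x#} \<subseteq># m"
      using that by (simp add: subset_eq_diff_conv)
    ultimately show ?thesis by blast
  next
    case False
    then have "u \<subseteq># m"
      using that by (metis diff_single_trivial subset_eq_diff_conv add_mset_add_single)
    then show ?thesis by blast
  qed
  then show ?case
    using add by (blast intro: finite_subset)
qed simp

definition poly_monom :: "'a ring \<Rightarrow> nat multiset \<Rightarrow> 'a \<Rightarrow> nat multiset \<Rightarrow> 'a" where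
  "poly_monom A m x = (\<lambda>n. if n = m then x else \<zero>\<^bsub>A\<^esub>)"

abbreviation poly_var :: "'a ring \<Rightarrow> nat \<Rightarrow> nat multiset \<Rightarrow> 'a" where
  "poly_var A i \<equiv> poly_monom A {#i#} \<one>\<^bsub>A\<^esub>"

lemma poly_const_monom: "poly_const A a = poly_monom A {#} a"
  by (simp add: poly_const_def poly_monom_def)

lemma poly_semiring_simps:
  "\<zero>\<^bsub>poly_semiring A d\<^esub> = (\<lambda>m. \<zero>\<^bsub>A\<^esub>)"
  "p \<oplus>\<^bsub>poly_semiring A d\<^esub> q = (\<lambda>m. p m \<oplus>\<^bsub>A\<^esub> q m)"
  "\<one>\<^bsub>poly_semiring A d\<^esub> = poly_monom A {#} \<one>\<^bsub>A\<^esub>"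
  "p \<otimes>\<^bsub>poly_semiring A d\<^esub> q = (\<lambda>m. \<Oplus>\<^bsub>A\<^esub>u\<in>{u. u \<subseteq># m}. p u \<otimes>\<^bsub>A\<^esub> q (m - u))"
  by (simp_all add: poly_semiring_def poly_monom_def)

locale polynomials = csemiring A for A :: "'a ring" (structure) and d :: nat +
  fixes P
  defines "P \<equiv> poly_semiring A d"
begin

lemma carrier_P:
  "p \<in> carrier P \<longleftrightarrow> (\<forall>m. p m \<in> carrier A) \<and> finite {m. p m \<noteq> \<zero>} \<and>
     (\<forall>m. \<not> set_mset m \<subseteq> {..<d} \<longrightarrow> p m = \<zero>)"
  by (simp add: P_def poly_semiring_def)

lemma coeff_closed: "p \<in> carrier P \<Longrightarrow> p m \<in> carrier A"
  by (simp add: carrier_P)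

lemma zero_closed_P: "\<zero>\<^bsub>P\<^esub> \<in> carrier P"
  by (simp add: carrier_P) (simp add: P_def poly_semiring_simps)

lemma add_closed_P:
  assumes "p \<in> carrier P" "q \<in> carrier P"
  shows "p \<oplus>\<^bsub>P\<^esub> q \<in> carrier P"
proof -
  have "{m. p m \<oplus> q m \<noteq> \<zero>} \<subseteq> {m. p m \<noteq> \<zero>} \<union> {m. q m \<noteq> \<zero>}"
    using assms by auto
  then have "finite {m. p m \<oplus> q m \<noteq> \<zero>}"
    using assms by (auto simp: carrier_P intro: finite_subset)
  then show ?thesis
    using assms unfolding carrier_P by (simp add: P_def poly_semiring_simps)
qed

lemma monom_closed:
  "\<lbrakk>x \<in> carrier A; set_mset m \<subseteq> {..<d}\<rbrakk> \<Longrightarrow> poly_monom A m x \<in> carrier P"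
  by (auto simp: carrier_P poly_monom_def)

lemma var_closed: "i < d \<Longrightarrow> poly_var A i \<in> carrier P"
  by (simp add: monom_closed)

lemma poly_induct [consumes 1, case_names zero add]:
  assumes p: "p \<in> carrier P" and zero: "Q \<zero>\<^bsub>P\<^esub>"
    and add: "\<And>p m x. \<lbrakk>p \<in> carrier P; Q p; x \<in> carrier A; set_mset m \<subseteq> {..<d}\<rbrakk> \<Longrightarrow>
      Q (p \<oplus>\<^bsub>P\<^esub> poly_monom A m x)"
  shows "Q p"
proof -
  have "Q p" if "finite S" "p \<in> carrier P" "{m. p m \<noteq> \<zero>} \<subseteq> S" for S p
    using that
  proof (induction S arbitrary: p)
    case empty
    then have "p = \<zero>\<^bsub>P\<^esub>" by (auto simp: P_def poly_semiring_simps)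
    then show ?case using zero by simp
  next
    case (insert m S)
    define p' where "p' = p(m := \<zero>)"
    have "p' \<in> carrier P"
      using insert.prems(1) unfolding carrier_P p'_def
      by (auto intro: finite_subset[of _ "{m. p m \<noteq> \<zero>}"])
    moreover have "{m. p' m \<noteq> \<zero>} \<subseteq> S"
      using insert.prems(2) by (auto simp: p'_def)
    ultimately have "Q p'" by (rule insert.IH)
    have split: "p = p' \<oplus>\<^bsub>P\<^esub> poly_monom A m (p m)"
      using coeff_closed[OF insert.prems(1)]
      by (auto simp: p'_def P_def poly_semiring_simps poly_monom_def fun_eq_iff)
    show ?case
    proof (cases "p m = \<zero>")
      case True
      then have "p' = p" by (auto simp: p'_def)
      then show ?thesis using \<open>Q p'\<close> by simp
    next
      case False
      then have "set_mset m \<subseteq> {..<d}"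
        using insert.prems(1) by (auto simp: carrier_P)
      then have "Q (p' \<oplus>\<^bsub>P\<^esub> poly_monom A m (p m))"
        using add \<open>p' \<in> carrier P\<close> \<open>Q p'\<close> coeff_closed[OF insert.prems(1)] by blast
      then show ?thesis using split by simp
    qed
  qed
  then show ?thesis
    using p by (auto simp: carrier_P)
qed

lemma mult_distrib_P:
  assumes "p \<in> carrier P" "q \<in> carrier P" "r \<in> carrier P"
  shows "(p \<oplus>\<^bsub>P\<^esub> q) \<otimes>\<^bsub>P\<^esub> r = p \<otimes>\<^bsub>P\<^esub> r \<oplus>\<^bsub>P\<^esub> q \<otimes>\<^bsub>P\<^esub> r"
    and "r \<otimes>\<^bsub>P\<^esub> (p \<oplus>\<^bsub>P\<^esub> q) = r \<otimes>\<^bsub>P\<^esub> p \<oplus>\<^bsub>P\<^esub> r \<otimes>\<^bsub>P\<^esub> q"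
  using assms[THEN coeff_closed]
  by (simp_all add: P_def poly_semiring_simps l_distr r_distr finsum_addf Pi_def)

lemma mult_zero_P:
  assumes "p \<in> carrier P"
  shows "\<zero>\<^bsub>P\<^esub> \<otimes>\<^bsub>P\<^esub> p = \<zero>\<^bsub>P\<^esub>" "p \<otimes>\<^bsub>P\<^esub> \<zero>\<^bsub>P\<^esub> = \<zero>\<^bsub>P\<^esub>"
  using assms[THEN coeff_closed] by (simp_all add: P_def poly_semiring_simps)

lemma monom_mult:
  assumes "x \<in> carrier A" "y \<in> carrier A"
  shows "poly_monom A m x \<otimes>\<^bsub>P\<^esub> poly_monom A n y = poly_monom A (m + n) (x \<otimes> y)"
proof
  fix k
  have "(poly_monom A m x \<otimes>\<^bsub>P\<^esub> poly_monom A n y) k =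
      (\<Oplus>u\<in>{u. u \<subseteq># k}. poly_monom A m x u \<otimes> poly_monom A n y (k - u))"
    by (simp add: P_def poly_semiring_simps)
  also have "\<dots> = (\<Oplus>u\<in>{u. u \<subseteq># k}. if m = u then x \<otimes> poly_monom A n y (k - u) else \<zero>)"
    using assms by (intro finsum_cong') (auto simp: poly_monom_def)
  also have "\<dots> = poly_monom A (m + n) (x \<otimes> y) k"
  proof (cases "m \<subseteq># k")
    case True
    have "(\<Oplus>u\<in>{u. u \<subseteq># k}. if m = u then x \<otimes> poly_monom A n y (k - u) else \<zero>) =
        x \<otimes> poly_monom A n y (k - m)"
      using True assms
      by (intro finsum_singleton) (auto simp: finite_submultisets poly_monom_def)
    also have "\<dots> = poly_monom A (m + n) (x \<otimes> y) k"
      using True assms by (auto simp: poly_monom_def dest: subset_mset.diff_add)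
    finally show ?thesis .
  next
    case False
    then have "(\<Oplus>u\<in>{u. u \<subseteq># k}. if m = u then x \<otimes> poly_monom A n y (k - u) else \<zero>) =
        (\<Oplus>u\<in>{u. u \<subseteq># k}. \<zero>)"
      by (intro finsum_cong') auto
    with False show ?thesis
      by (auto simp: poly_monom_def)
  qed
  finally show "(poly_monom A m x \<otimes>\<^bsub>P\<^esub> poly_monom A n y) k = poly_monom A (m + n) (x \<otimes> y) k" .
qed

lemma mult_closed_P:
  assumes "p \<in> carrier P" "q \<in> carrier P"
  shows "p \<otimes>\<^bsub>P\<^esub> q \<in> carrier P"
  using assms(1)
proof (induction p rule: poly_induct)
  case zero
  then show ?case using mult_zero_P(1)[OF assms(2)] zero_closed_P by simp
next
  case (add p m x)
  have "poly_monom A m x \<otimes>\<^bsub>P\<^esub> q \<in> carrier P"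
    using assms(2)
  proof (induction q rule: poly_induct)
    case zero
    then show ?case using mult_zero_P(2)[OF monom_closed] add zero_closed_P by simp
  next
    case (add q n y)
    then show ?case
      using \<open>x \<in> carrier A\<close> \<open>set_mset m \<subseteq> {..<d}\<close>
      by (simp add: mult_distrib_P monom_closed monom_mult add_closed_P)
  qed
  then show ?case
    using add assms(2) by (simp add: mult_distrib_P monom_closed add_closed_P)
qed

lemma monom_add_mset:
  "x \<in> carrier A \<Longrightarrow> poly_monom A (add_mset i m) x = poly_monom A m x \<otimes>\<^bsub>P\<^esub> poly_var A i"
  by (simp add: monom_mult)

text \<open>Constants and variables generate the polynomial semiring.\<close>

lemma poly_hom_eqI:
  assumes k: "k \<in> csemiring_hom P C" "k' \<in> csemiring_hom P C"
    and const: "\<And>x. x \<in> carrier A \<Longrightarrow> k (poly_const A x) = k' (poly_const A x)"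
    and var: "\<And>i. i < d \<Longrightarrow> k (poly_var A i) = k' (poly_var A i)"
    and p: "p \<in> carrier P"
  shows "k p = k' p"
  using p
proof (induction p rule: poly_induct)
  case zero
  then show ?case using k by (simp add: csemiring_homD)
next
  case (add p m x)
  have "k (poly_monom A m x) = k' (poly_monom A m x)"
    using \<open>set_mset m \<subseteq> {..<d}\<close>
  proof (induction m)
    case empty
    then show ?case using const[OF \<open>x \<in> carrier A\<close>] by (simp add: poly_const_monom)
  next
    case (add i m)
    then show ?case
      using \<open>x \<in> carrier A\<close> var
      by (simp add: monom_add_mset[of x i m] csemiring_homD[OF k(1)] csemiring_homD[OF k(2)] monom_closed)
  qed
  then show ?case
    using add by (simp add: csemiring_homD[OF k(1)] csemiring_homD[OF k(2)] monom_closed)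
qed

text \<open>
  Evaluation is defined term by term; multiplicativity reduces by bilinearity to monomials, where it
  expresses that \<open>val m\<close>, the product of the \<open>t i\<close> over the multiset \<open>m\<close>, is multiplicative in \<open>m\<close>.
\<close>

lemma ex_poly_eval:
  assumes C: "csemiring C" and c: "c \<in> csemiring_hom A C"
    and t: "\<And>i. i < d \<Longrightarrow> t i \<in> carrier C"
  shows "\<exists>k\<in>alg_hom A P (poly_const A) C c. \<forall>i<d. k (poly_var A i) = t i"
proof -
  interpret C: csemiring C by fact
  note cD [simp] = csemiring_homD[OF c]
  define val where "val m = (\<Otimes>\<^bsub>C\<^esub>i\<in>{..<d}. t i [^]\<^bsub>C\<^esub> count m i)" for m
  have val_closed [simp]: "val m \<in> carrier C" for m
    unfolding val_def using t by (intro C.finprod_closed) auto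
  have val_empty: "val {#} = \<one>\<^bsub>C\<^esub>"
    by (simp add: val_def)
  have val_plus: "val (m + n) = val m \<otimes>\<^bsub>C\<^esub> val n" for m n
  proof -
    have "val (m + n) = (\<Otimes>\<^bsub>C\<^esub>i\<in>{..<d}. t i [^]\<^bsub>C\<^esub> count m i \<otimes>\<^bsub>C\<^esub> t i [^]\<^bsub>C\<^esub> count n i)"
      unfolding val_def using t by (intro C.finprod_cong') (auto simp: C.nat_pow_mult)
    then show ?thesis
      unfolding val_def using t by (simp add: Pi_def)
  qed
  have val_single: "val {#i#} = t i" if "i < d" for i
  proof -
    have "val {#i#} = (\<Otimes>\<^bsub>C\<^esub>j\<in>{..<d}. if i = j then t j else \<one>\<^bsub>C\<^esub>)"
      unfolding val_def using t by (intro C.finprod_cong') auto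
    also have "\<dots> = t i"
      using that t by (intro C.finprod_singleton) auto
    finally show ?thesis .
  qed
  define ev where "ev p = (\<Oplus>\<^bsub>C\<^esub>m\<in>{m. p m \<noteq> \<zero>}. c (p m) \<otimes>\<^bsub>C\<^esub> val m)" for p
  have ev_on: "ev p = (\<Oplus>\<^bsub>C\<^esub>m\<in>S. c (p m) \<otimes>\<^bsub>C\<^esub> val m)"
    if "p \<in> carrier P" "finite S" "{m. p m \<noteq> \<zero>} \<subseteq> S" for p S
    unfolding ev_def using that coeff_closed[OF that(1)]
    by (intro C.add.finprod_mono_neutral_cong_left) auto
  have ev_closed [simp]: "ev p \<in> carrier C" if "p \<in> carrier P" for p
    unfolding ev_def using coeff_closed[OF that] by (intro C.finsum_closed) auto
  have ev_add: "ev (p \<oplus>\<^bsub>P\<^esub> q) = ev p \<oplus>\<^bsub>C\<^esub> ev q" if pq: "p \<in> carrier P" "q \<in> carrier P" for p q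
  proof -
    let ?S = "{m. p m \<noteq> \<zero>} \<union> {m. q m \<noteq> \<zero>}"
    have pq': "(p \<oplus>\<^bsub>P\<^esub> q) m = p m \<oplus> q m" for m
      by (simp add: P_def poly_semiring_simps)
    have fin: "finite ?S"
      using pq by (simp add: carrier_P)
    have "{m. (p \<oplus>\<^bsub>P\<^esub> q) m \<noteq> \<zero>} \<subseteq> ?S"
      by (auto simp: pq')
    then have "ev (p \<oplus>\<^bsub>P\<^esub> q) = (\<Oplus>\<^bsub>C\<^esub>m\<in>?S. c ((p \<oplus>\<^bsub>P\<^esub> q) m) \<otimes>\<^bsub>C\<^esub> val m)"
      by (intro ev_on add_closed_P pq fin)
    also have "\<dots> = (\<Oplus>\<^bsub>C\<^esub>m\<in>?S. c (p m) \<otimes>\<^bsub>C\<^esub> val m \<oplus>\<^bsub>C\<^esub> c (q m) \<otimes>\<^bsub>C\<^esub> val m)"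
      using pq[THEN coeff_closed] by (simp add: pq' C.l_distr)
    also have "\<dots> = (\<Oplus>\<^bsub>C\<^esub>m\<in>?S. c (p m) \<otimes>\<^bsub>C\<^esub> val m) \<oplus>\<^bsub>C\<^esub> (\<Oplus>\<^bsub>C\<^esub>m\<in>?S. c (q m) \<otimes>\<^bsub>C\<^esub> val m)"
      using pq[THEN coeff_closed] by (intro C.finsum_addf) auto
    also have "\<dots> = ev p \<oplus>\<^bsub>C\<^esub> ev q"
      using ev_on[OF pq(1) fin] ev_on[OF pq(2) fin] by simp
    finally show ?thesis .
  qed
  have ev_monom: "ev (poly_monom A m x) = c x \<otimes>\<^bsub>C\<^esub> val m"
    if "x \<in> carrier A" "set_mset m \<subseteq> {..<d}" for x m
  proof -
    have "{n. poly_monom A m x n \<noteq> \<zero>} \<subseteq> {m}"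
      by (auto simp: poly_monom_def)
    then have "ev (poly_monom A m x) = (\<Oplus>\<^bsub>C\<^esub>n\<in>{m}. c (poly_monom A m x n) \<otimes>\<^bsub>C\<^esub> val n)"
      by (intro ev_on monom_closed that) auto
    then show ?thesis
      using that by (simp add: poly_monom_def)
  qed
  have ev_zero: "ev \<zero>\<^bsub>P\<^esub> = \<zero>\<^bsub>C\<^esub>"
    by (simp add: ev_def P_def poly_semiring_simps)
  have ev_mult: "ev (p \<otimes>\<^bsub>P\<^esub> q) = ev p \<otimes>\<^bsub>C\<^esub> ev q" if p: "p \<in> carrier P" and q: "q \<in> carrier P" for p q
    using p
  proof (induction p rule: poly_induct)
    case zero
    then show ?case using q by (simp add: mult_zero_P ev_zero)
  next
    case (add p m x)
    have "ev (poly_monom A m x \<otimes>\<^bsub>P\<^esub> q) = ev (poly_monom A m x) \<otimes>\<^bsub>C\<^esub> ev q"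
      using q
    proof (induction q rule: poly_induct)
      case zero
      then show ?case using add by (simp add: mult_zero_P ev_zero monom_closed)
    next
      case (add q n y)
      then have "ev (poly_monom A m x \<otimes>\<^bsub>P\<^esub> poly_monom A n y) =
          ev (poly_monom A m x) \<otimes>\<^bsub>C\<^esub> ev (poly_monom A n y)"
        using \<open>x \<in> carrier A\<close> \<open>set_mset m \<subseteq> {..<d}\<close>
        by (simp add: monom_mult ev_monom val_plus C.m_ac)
      then show ?case
        using add \<open>x \<in> carrier A\<close> \<open>set_mset m \<subseteq> {..<d}\<close>
        by (simp add: mult_distrib_P monom_closed ev_add mult_closed_P C.r_distr)
    qed
    then show ?case
      using add q by (simp add: mult_distrib_P monom_closed ev_add mult_closed_P C.l_distr)
  qed
  have "ev \<in> csemiring_hom P C"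
  proof (rule csemiring_homI)
    have "\<one>\<^bsub>P\<^esub> = poly_monom A {#} \<one>" by (simp add: P_def poly_semiring_simps)
    then show "ev \<one>\<^bsub>P\<^esub> = \<one>\<^bsub>C\<^esub>" by (simp add: ev_monom val_empty)
  qed (auto simp: ev_mult ev_add ev_zero)
  then have "ev \<in> alg_hom A P (poly_const A) C c"
    by (simp add: alg_hom_def poly_const_monom ev_monom val_empty)
  moreover have "\<forall>i<d. ev (poly_var A i) = t i"
    using t by (simp add: ev_monom val_single)
  ultimately show ?thesis by blast
qed

text \<open>
  The equation \<open>c a \<otimes> k (poly_var A i) = c (n i)\<close> says that \<open>k\<close> evaluates the variables at the fractions
  \<open>n i / a\<close>. The numerator \<open>z\<close> and the exponent \<open>l\<close> are the same for all \<open>C\<close>, which makes it possible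
  to transport an equation that holds in \<open>B\<close> to the localisations of \<open>A\<close>.
\<close>

lemma poly_clear_denominators:
  fixes n :: "nat \<Rightarrow> 'a"
  assumes a: "a \<in> carrier A" and n: "\<forall>i<d. n i \<in> carrier A"
    and p: "p \<in> carrier P"
  shows "\<exists>l::nat. \<exists>z\<in>carrier A. \<forall>(C :: 'c ring) c k.
    csemiring C \<longrightarrow> c \<in> csemiring_hom A C \<longrightarrow> k \<in> alg_hom A P (poly_const A) C c \<longrightarrow>
    (\<forall>i<d. c a \<otimes>\<^bsub>C\<^esub> k (poly_var A i) = c (n i)) \<longrightarrow> c (a [^] l) \<otimes>\<^bsub>C\<^esub> k p = c z"
proof -
  define good :: "(nat multiset \<Rightarrow> 'a) \<Rightarrow> nat \<Rightarrow> 'a \<Rightarrow> bool" where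
    "good p l z \<longleftrightarrow> (\<forall>(C :: 'c ring) c k.
      csemiring C \<longrightarrow> c \<in> csemiring_hom A C \<longrightarrow> k \<in> alg_hom A P (poly_const A) C c \<longrightarrow>
      (\<forall>i<d. c a \<otimes>\<^bsub>C\<^esub> k (poly_var A i) = c (n i)) \<longrightarrow> c (a [^] l) \<otimes>\<^bsub>C\<^esub> k p = c z)" for p l z
  have monom: "\<exists>l. \<exists>z\<in>carrier A. good (poly_monom A m x) l z"
    if x: "x \<in> carrier A" and m: "set_mset m \<subseteq> {..<d}" for m x
    using m
  proof (induction m)
    case empty
    have "c (a [^] (0::nat)) \<otimes>\<^bsub>C\<^esub> k (poly_monom A {#} x) = c x"
      if "csemiring C" "c \<in> csemiring_hom A C" "k \<in> alg_hom A P (poly_const A) C c"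
      for C :: "'c ring" and c k
    proof -
      interpret C: csemiring C by fact
      show ?thesis
        using that x csemiring_homD[OF that(2)] by (simp add: alg_hom_def poly_const_monom)
    qed
    then have "good (poly_monom A {#} x) 0 x"
      unfolding good_def by blast
    then show ?case using x by blast
  next
    case (add i m)
    then obtain l z where z: "z \<in> carrier A" and g: "good (poly_monom A m x) l z"
      by auto
    have i: "i < d" and m: "set_mset m \<subseteq> {..<d}" using add.prems by auto
    have "c (a [^] Suc l) \<otimes>\<^bsub>C\<^esub> k (poly_monom A (add_mset i m) x) = c (z \<otimes> n i)"
      if C: "csemiring C" and c: "c \<in> csemiring_hom A C" and k: "k \<in> alg_hom A P (poly_const A) C c"
        and v: "\<forall>i<d. c a \<otimes>\<^bsub>C\<^esub> k (poly_var A i) = c (n i)"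
      for C :: "'c ring" and c k
    proof -
      interpret C: csemiring C by fact
      have kh: "k \<in> csemiring_hom P C" using k by (simp add: alg_hom_def)
      note [simp] = csemiring_homD[OF c] csemiring_homD[OF kh] monom_closed
      have "c (a [^] Suc l) \<otimes>\<^bsub>C\<^esub> k (poly_monom A (add_mset i m) x) =
          (c (a [^] l) \<otimes>\<^bsub>C\<^esub> c a) \<otimes>\<^bsub>C\<^esub> (k (poly_monom A m x) \<otimes>\<^bsub>C\<^esub> k (poly_var A i))"
        using x m i a by (simp add: monom_add_mset[of x i m])
      also have "\<dots> = (c (a [^] l) \<otimes>\<^bsub>C\<^esub> k (poly_monom A m x)) \<otimes>\<^bsub>C\<^esub> (c a \<otimes>\<^bsub>C\<^esub> k (poly_var A i))"
        using x m i a by (simp add: C.m_ac)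
      also have "\<dots> = c z \<otimes>\<^bsub>C\<^esub> c (n i)"
        using g C c k v i unfolding good_def by simp
      finally show ?thesis
        using z n i by simp
    qed
    then have "good (poly_monom A (add_mset i m) x) (Suc l) (z \<otimes> n i)"
      unfolding good_def by blast
    then show ?case using z n i by blast
  qed
  have "\<exists>l. \<exists>z\<in>carrier A. good p l z"
    using p
  proof (induction p rule: poly_induct)
    case zero
    have "c (a [^] (0::nat)) \<otimes>\<^bsub>C\<^esub> k \<zero>\<^bsub>P\<^esub> = c \<zero>"
      if "csemiring C" "c \<in> csemiring_hom A C" "k \<in> alg_hom A P (poly_const A) C c"
      for C :: "'c ring" and c k
    proof -
      interpret C: csemiring C by fact
      show ?thesis
        using that csemiring_homD[OF that(2)] csemiring_homD(5)[of k P C] by (simp add: alg_hom_def)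
    qed
    then have "good \<zero>\<^bsub>P\<^esub> 0 \<zero>"
      unfolding good_def by blast
    then show ?case by blast
  next
    case (add p m x)
    obtain l z where z: "z \<in> carrier A" and g: "good p l z"
      using add by blast
    obtain l' z' where z': "z' \<in> carrier A" and g': "good (poly_monom A m x) l' z'"
      using monom add by blast
    have "c (a [^] (l + l')) \<otimes>\<^bsub>C\<^esub> k (p \<oplus>\<^bsub>P\<^esub> poly_monom A m x) = c (a [^] l' \<otimes> z \<oplus> a [^] l \<otimes> z')"
      if C: "csemiring C" and c: "c \<in> csemiring_hom A C" and k: "k \<in> alg_hom A P (poly_const A) C c"
        and v: "\<forall>i<d. c a \<otimes>\<^bsub>C\<^esub> k (poly_var A i) = c (n i)"
      for C :: "'c ring" and c k
    proof -
      interpret C: csemiring C by fact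
      have kh: "k \<in> csemiring_hom P C" using k by (simp add: alg_hom_def)
      note [simp] = csemiring_homD[OF c] csemiring_homD[OF kh] monom_closed
      have "c (a [^] (l + l')) = c (a [^] l) \<otimes>\<^bsub>C\<^esub> c (a [^] l')"
        using a by (simp add: nat_pow_mult[symmetric])
      then have "c (a [^] (l + l')) \<otimes>\<^bsub>C\<^esub> k (p \<oplus>\<^bsub>P\<^esub> poly_monom A m x) =
          c (a [^] l') \<otimes>\<^bsub>C\<^esub> (c (a [^] l) \<otimes>\<^bsub>C\<^esub> k p) \<oplus>\<^bsub>C\<^esub>
          c (a [^] l) \<otimes>\<^bsub>C\<^esub> (c (a [^] l') \<otimes>\<^bsub>C\<^esub> k (poly_monom A m x))"
        using a add by (simp add: C.r_distr C.m_ac)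
      also have "\<dots> = c (a [^] l') \<otimes>\<^bsub>C\<^esub> c z \<oplus>\<^bsub>C\<^esub> c (a [^] l) \<otimes>\<^bsub>C\<^esub> c z'"
        using g g' C c k v unfolding good_def by simp
      finally show ?thesis
        using z z' a by simp
    qed
    then have "good (p \<oplus>\<^bsub>P\<^esub> poly_monom A m x) (l + l') (a [^] l' \<otimes> z \<oplus> a [^] l \<otimes> z')"
      unfolding good_def by blast
    then show ?case using z z' a by blast
  qed
  then show ?thesis
    unfolding good_def .
qed

end

section \<open>Flat epimorphisms are topological embeddings on spectra\<close>

text \<open>The prime \<open>q\<close> can be recovered from its contraction, as \<open>c\<close> is a numerator of \<open>b\<close>.\<close>

lemma prime_mem_iff_numerator:
  assumes B: "csemiring B" and f: "f \<in> csemiring_hom A B" and q: "csemiring_prime B q"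
    and "a \<in> carrier A" "c \<in> carrier A" "b \<in> carrier B" "a \<notin> Spec_map A f q" "f a \<otimes>\<^bsub>B\<^esub> b = f c"
  shows "b \<in> q \<longleftrightarrow> c \<in> Spec_map A f q"
  using prime_mult_iff[OF B q csemiring_homD(1)[OF f], of a b] assms by (auto simp: Spec_map_def)

lemma flat_epi_Spec_embedding:
  fixes A B :: "('u::infinite) ring"
  assumes A: "csemiring A" and B: "csemiring B" and flat: "flat_hom A B f"
    and epi: "csemiring_epi A B f"
  shows "homeomorphic_map (Spec B)
    (subtopology (Spec A) (Spec_map A f ` topspace (Spec B))) (Spec_map A f)"
proof -
  have f: "f \<in> csemiring_hom A B" using flat by (simp add: flat_hom_def)
  let ?F = "Spec_map A f" and ?U = "Spec_map A f ` topspace (Spec B)"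
  note tops = topspace_Spec[OF A] topspace_Spec[OF B]
  note cont = continuous_map_Spec_map[OF A B f]
  have sub: "?U \<subseteq> topspace (Spec A)"
    using Spec_map_prime[OF A f] by (auto simp: tops)
  have fraction: "\<exists>a\<in>carrier A. \<exists>c\<in>carrier A. a \<notin> ?F q \<and> f a \<otimes>\<^bsub>B\<^esub> b = f c"
    if "csemiring_prime B q" "b \<in> carrier B" for q b
    using flat_epi_denominator[OF A B flat epi that(2,1)] by (auto simp: Spec_map_def)
  have inj: "inj_on ?F (topspace (Spec B))"
  proof (rule inj_onI)
    fix q q' assume "q \<in> topspace (Spec B)" "q' \<in> topspace (Spec B)" and eq: "?F q = ?F q'"
    then have q: "csemiring_prime B q" "csemiring_prime B q'" by (auto simp: tops)
    have "b \<in> q \<longleftrightarrow> b \<in> q'" if b: "b \<in> carrier B" for b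
    proof -
      obtain a c where ac: "a \<in> carrier A" "c \<in> carrier A" "a \<notin> ?F q" "f a \<otimes>\<^bsub>B\<^esub> b = f c"
        using fraction[OF q(1) b] by blast
      then have "a \<notin> ?F q'" using eq by simp
      show ?thesis
        using prime_mem_iff_numerator[OF B f q(1) ac(1,2) b ac(3,4)]
          prime_mem_iff_numerator[OF B f q(2) ac(1,2) b \<open>a \<notin> ?F q'\<close> ac(4)] eq by simp
    qed
    then show "q = q'"
      using csemiring_primeD(1)[OF q(1)] csemiring_primeD(1)[OF q(2)] by blast
  qed
  have "openin (subtopology (Spec A) ?U) (?F ` W)" if W: "openin (Spec B) W" for W
  proof (subst openin_subopen, intro ballI)
    fix x assume "x \<in> ?F ` W"
    then obtain q where q: "q \<in> W" "x = ?F q" by blast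
    then obtain b where b: "b \<in> carrier B" "q \<in> basic_open B b" "basic_open B b \<subseteq> W"
      using W openin_Spec_iff[OF B] by meson
    then have prime: "csemiring_prime B q" and bq: "b \<notin> q" by (auto simp: basic_open_def)
    obtain a c where ac: "a \<in> carrier A" "c \<in> carrier A" "a \<notin> ?F q" "f a \<otimes>\<^bsub>B\<^esub> b = f c"
      using fraction[OF prime b(1)] by blast
    let ?T = "basic_open A a \<inter> basic_open A c \<inter> ?U"
    have "openin (subtopology (Spec A) ?U) ?T"
      by (intro openin_subtopology_Int openin_Int openin_Spec_basic ac)
    moreover have "x \<in> ?T"
      using q prime ac bq b(1) prime_mem_iff_numerator[OF B f prime] Spec_map_prime[OF A f prime]
      by (auto simp: basic_open_def tops)
    moreover have "?T \<subseteq> ?F ` W"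
    proof
      fix y assume y: "y \<in> ?T"
      then obtain q' where q': "csemiring_prime B q'" "y = ?F q'" by (auto simp: tops)
      then have "b \<notin> q'"
        using y ac prime_mem_iff_numerator[OF B f q'(1) ac(1,2) b(1) _ ac(4)]
        by (auto simp: basic_open_def)
      then show "y \<in> ?F ` W"
        using q' b(3) by (auto simp: basic_open_def)
    qed
    ultimately show "\<exists>T. openin (subtopology (Spec A) ?U) T \<and> x \<in> T \<and> T \<subseteq> ?F ` W"
      by blast
  qed
  then have "open_map (Spec B) (subtopology (Spec A) ?U) ?F"
    by (simp add: open_map_def)
  moreover have "continuous_map (Spec B) (subtopology (Spec A) ?U) ?F"
    using cont by (simp add: continuous_map_in_subtopology)
  ultimately show ?thesis
    using inj sub by (intro bijective_open_imp_homeomorphic_map) (auto simp: inf_absorb2)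
qed

section \<open>The image is open\<close>

text \<open>Multiplying witnesses keeps them outside the prime, so finitely many conditions are met by one element.\<close>

lemma prime_common_multiple:
  fixes A (structure)
  assumes A: "csemiring A" and p: "csemiring_prime A p"
    and ex: "\<And>j. j < (r::nat) \<Longrightarrow> \<exists>e\<in>carrier A - p. W j e"
    and mult: "\<And>j e x. \<lbrakk>j < r; W j e; e \<in> carrier A; x \<in> carrier A\<rbrakk> \<Longrightarrow> W j (e \<otimes> x)"
  shows "\<exists>e\<in>carrier A - p. \<forall>j<r. W j e"
proof -
  interpret csemiring A by fact
  have "\<exists>e\<in>carrier A - p. \<forall>j<s. W j e" if "s \<le> r" for s
    using that
  proof (induction s)
    case 0
    then show ?case using csemiring_primeD[OF p] by blast
  next
    case (Suc s)
    then obtain e where e: "e \<in> carrier A - p" "\<forall>j<s. W j e" by auto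
    obtain e' where e': "e' \<in> carrier A - p" "W s e'" using ex[of s] Suc.prems by auto
    have "W j (e \<otimes> e')" if "j < Suc s" for j
    proof (cases "j = s")
      case True
      then have "W j (e' \<otimes> e)" using mult[of s e' e] e e' Suc by auto
      then show ?thesis using e e' m_comm by auto
    next
      case False
      then show ?thesis using mult[of j e e'] e e' Suc that by auto
    qed
    moreover have "e \<otimes> e' \<in> carrier A - p"
      using e e' by (simp add: prime_mult_iff[OF A p])
    ultimately show ?case by blast
  qed
  then show ?thesis by simp
qed

text \<open>
  Near \<open>q\<close> the generators of \<open>B\<close> are fractions \<open>n i / a\<close>. The two sides of a relation, evaluated at these
  fractions, have numerators whose images in \<open>B\<close> agree up to powers of \<open>a\<close>; hence they agree in \<open>A\<close>
  after multiplication with an element whose image is not in \<open>q\<close>. The product of \<open>a\<close> with these finitely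
  many elements is such that, once it is inverted, \<open>n i / a\<close> satisfies the relations of \<open>B\<close>, and the
  coequaliser provides a map from \<open>B\<close>.
\<close>

lemma flat_fp_epi_local_section:
  fixes A B :: "('u::infinite) ring"
  assumes A: "csemiring A" and B: "csemiring B" and flat: "flat_hom A B f"
    and epi: "csemiring_epi A B f" and fp: "finitely_presented_hom A B f"
    and q: "csemiring_prime B q"
  shows "\<exists>e\<in>carrier A. f e \<notin> q \<and> (\<forall>(C :: 'u ring) c.
    csemiring C \<longrightarrow> c \<in> csemiring_hom A C \<longrightarrow> (\<exists>v\<in>carrier C. c e \<otimes>\<^bsub>C\<^esub> v = \<one>\<^bsub>C\<^esub>) \<longrightarrow>
    alg_hom A B f C c \<noteq> {})"
proof -
  have f: "f \<in> csemiring_hom A B" using flat by (simp add: flat_hom_def)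
  interpret A: csemiring A by fact
  interpret B: csemiring B by fact
  obtain r d g h \<pi> where
    g: "g \<in> alg_hom A (poly_semiring A r) (poly_const A) (poly_semiring A d) (poly_const A)" and
    h: "h \<in> alg_hom A (poly_semiring A r) (poly_const A) (poly_semiring A d) (poly_const A)" and
    coeq: "alg_coequaliser A (poly_semiring A r) (poly_semiring A d) (poly_const A) g h B f \<pi>"
    using fp unfolding finitely_presented_hom_def by blast
  define R Q where "R = poly_semiring A r" and "Q = poly_semiring A d"
  interpret R: polynomials A r R by unfold_locales (simp add: R_def)
  interpret Q: polynomials A d Q by unfold_locales (simp add: Q_def)
  have \<pi>: "\<pi> \<in> alg_hom A Q (poly_const A) B f"
    and \<pi>gh: "\<And>x. x \<in> carrier R \<Longrightarrow> \<pi> (g x) = \<pi> (h x)"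
    using coeq by (auto simp: alg_coequaliser_def Q_def R_def)
  have gR: "g \<in> csemiring_hom R Q" and hR: "h \<in> csemiring_hom R Q" and \<pi>Q: "\<pi> \<in> csemiring_hom Q B"
    using g h \<pi> by (auto simp: alg_hom_def Q_def R_def)
  note [simp] = csemiring_homD[OF f]
  define p where "p = Spec_map A f q"
  have p: "csemiring_prime A p"
    unfolding p_def by (rule Spec_map_prime[OF A f q])
  have mem_p: "a \<notin> p \<longleftrightarrow> f a \<notin> q" if "a \<in> carrier A" for a
    using that by (simp add: p_def Spec_map_def)
  have "\<exists>a\<in>carrier A - p. \<forall>i<d. \<exists>x\<in>carrier A. f a \<otimes>\<^bsub>B\<^esub> \<pi> (poly_var A i) = f x"
  proof (rule prime_common_multiple[OF A p])
    fix i assume "i < d"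
    then have "\<pi> (poly_var A i) \<in> carrier B"
      using csemiring_homD(1)[OF \<pi>Q] Q.var_closed by blast
    from flat_epi_denominator[OF A B flat epi this q]
    show "\<exists>a\<in>carrier A - p. \<exists>x\<in>carrier A. f a \<otimes>\<^bsub>B\<^esub> \<pi> (poly_var A i) = f x"
      using mem_p by auto
  next
    fix i a y assume i: "i < d" and a: "a \<in> carrier A" and y: "y \<in> carrier A"
      and "\<exists>x\<in>carrier A. f a \<otimes>\<^bsub>B\<^esub> \<pi> (poly_var A i) = f x"
    then obtain x where x: "x \<in> carrier A" "f a \<otimes>\<^bsub>B\<^esub> \<pi> (poly_var A i) = f x" by blast
    have "\<pi> (poly_var A i) \<in> carrier B"
      using csemiring_homD(1)[OF \<pi>Q] Q.var_closed[OF i] by blast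
    then have "f (a \<otimes>\<^bsub>A\<^esub> y) \<otimes>\<^bsub>B\<^esub> \<pi> (poly_var A i) = f y \<otimes>\<^bsub>B\<^esub> (f a \<otimes>\<^bsub>B\<^esub> \<pi> (poly_var A i))"
      using a y by (simp add: B.m_ac)
    then show "\<exists>x\<in>carrier A. f (a \<otimes>\<^bsub>A\<^esub> y) \<otimes>\<^bsub>B\<^esub> \<pi> (poly_var A i) = f x"
      using x y by (intro bexI[of _ "y \<otimes>\<^bsub>A\<^esub> x"]) auto
  qed
  then obtain a where a: "a \<in> carrier A" "a \<notin> p"
    and "\<forall>i<d. \<exists>x. x \<in> carrier A \<and> f a \<otimes>\<^bsub>B\<^esub> \<pi> (poly_var A i) = f x"
    by blast
  from this(3) obtain n where n: "\<And>i. i < d \<Longrightarrow> n i \<in> carrier A"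
    and an: "\<And>i. i < d \<Longrightarrow> f a \<otimes>\<^bsub>B\<^esub> \<pi> (poly_var A i) = f (n i)"
    by metis
  have n_all: "\<forall>i<d. n i \<in> carrier A" using n by blast
  \<comment> \<open>The \<open>j\<close>-th relation holds after multiplication with \<open>e\<close>, wherever the variables are sent to \<open>n i / a\<close>.\<close>
  define W where "W j e \<longleftrightarrow> (\<forall>(C :: 'u ring) c k.
    csemiring C \<longrightarrow> c \<in> csemiring_hom A C \<longrightarrow> k \<in> alg_hom A Q (poly_const A) C c \<longrightarrow>
    (\<forall>i<d. c a \<otimes>\<^bsub>C\<^esub> k (poly_var A i) = c (n i)) \<longrightarrow>
    c e \<otimes>\<^bsub>C\<^esub> k (g (poly_var A j)) = c e \<otimes>\<^bsub>C\<^esub> k (h (poly_var A j)))" for j e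
  have "\<exists>e\<in>carrier A - p. \<forall>j<r. W j e"
  proof (rule prime_common_multiple[OF A p])
    fix j assume j: "j < r"
    have gj: "g (poly_var A j) \<in> carrier Q" and hj: "h (poly_var A j) \<in> carrier Q"
      using csemiring_homD(1)[OF gR] csemiring_homD(1)[OF hR] R.var_closed[OF j] by auto
    obtain l z where z: "z \<in> carrier A" and
      "\<forall>(C :: 'u ring) c k. csemiring C \<longrightarrow> c \<in> csemiring_hom A C \<longrightarrow>
        k \<in> alg_hom A Q (poly_const A) C c \<longrightarrow>
        (\<forall>i<d. c a \<otimes>\<^bsub>C\<^esub> k (poly_var A i) = c (n i)) \<longrightarrow>
        c (a [^]\<^bsub>A\<^esub> (l::nat)) \<otimes>\<^bsub>C\<^esub> k (g (poly_var A j)) = c z"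
      using Q.poly_clear_denominators[OF a(1) n_all gj, where 'c = 'u]
      by (elim exE bexE) (rule that)
    note gz = this(2)[THEN spec, THEN spec, THEN spec, THEN mp, THEN mp, THEN mp, THEN mp]
    obtain l' z' where z': "z' \<in> carrier A" and
      "\<forall>(C :: 'u ring) c k. csemiring C \<longrightarrow> c \<in> csemiring_hom A C \<longrightarrow>
        k \<in> alg_hom A Q (poly_const A) C c \<longrightarrow>
        (\<forall>i<d. c a \<otimes>\<^bsub>C\<^esub> k (poly_var A i) = c (n i)) \<longrightarrow>
        c (a [^]\<^bsub>A\<^esub> (l'::nat)) \<otimes>\<^bsub>C\<^esub> k (h (poly_var A j)) = c z'"
      using Q.poly_clear_denominators[OF a(1) n_all hj, where 'c = 'u]
      by (elim exE bexE) (rule that)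
    note hz = this(2)[THEN spec, THEN spec, THEN spec, THEN mp, THEN mp, THEN mp, THEN mp]
    let ?b = "\<pi> (g (poly_var A j))"
    have b: "?b \<in> carrier B"
      using csemiring_homD(1)[OF \<pi>Q gj] .
    have "f (a [^]\<^bsub>A\<^esub> l) \<otimes>\<^bsub>B\<^esub> ?b = f z" "f (a [^]\<^bsub>A\<^esub> l') \<otimes>\<^bsub>B\<^esub> ?b = f z'"
      using gz[OF B f \<pi>] hz[OF B f \<pi>] an \<pi>gh[OF R.var_closed[OF j]] by auto
    then have "f (a [^]\<^bsub>A\<^esub> l' \<otimes>\<^bsub>A\<^esub> z) = f (a [^]\<^bsub>A\<^esub> l') \<otimes>\<^bsub>B\<^esub> (f (a [^]\<^bsub>A\<^esub> l) \<otimes>\<^bsub>B\<^esub> ?b)"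
      and "f (a [^]\<^bsub>A\<^esub> l \<otimes>\<^bsub>A\<^esub> z') = f (a [^]\<^bsub>A\<^esub> l) \<otimes>\<^bsub>B\<^esub> (f (a [^]\<^bsub>A\<^esub> l') \<otimes>\<^bsub>B\<^esub> ?b)"
      using a z z' by simp_all
    then have "f (a [^]\<^bsub>A\<^esub> l' \<otimes>\<^bsub>A\<^esub> z) = f (a [^]\<^bsub>A\<^esub> l \<otimes>\<^bsub>A\<^esub> z')"
      using a b by (simp add: B.m_lcomm)
    then obtain e where e: "e \<in> carrier A" "f e \<notin> q"
      and ez: "e \<otimes>\<^bsub>A\<^esub> (a [^]\<^bsub>A\<^esub> l' \<otimes>\<^bsub>A\<^esub> z) = e \<otimes>\<^bsub>A\<^esub> (a [^]\<^bsub>A\<^esub> l \<otimes>\<^bsub>A\<^esub> z')"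
      using flat_annihilator[OF A B flat _ _ _ q, of "a [^]\<^bsub>A\<^esub> l' \<otimes>\<^bsub>A\<^esub> z" "a [^]\<^bsub>A\<^esub> l \<otimes>\<^bsub>A\<^esub> z'"] a z z'
      by auto
    let ?e = "e \<otimes>\<^bsub>A\<^esub> (a [^]\<^bsub>A\<^esub> l \<otimes>\<^bsub>A\<^esub> a [^]\<^bsub>A\<^esub> l')"
    have "c ?e \<otimes>\<^bsub>C\<^esub> k (g (poly_var A j)) = c ?e \<otimes>\<^bsub>C\<^esub> k (h (poly_var A j))"
      if C: "csemiring C" and c: "c \<in> csemiring_hom A C" and k: "k \<in> alg_hom A Q (poly_const A) C c"
        and v: "\<forall>i<d. c a \<otimes>\<^bsub>C\<^esub> k (poly_var A i) = c (n i)"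
      for C :: "'u ring" and c k
    proof -
      interpret C: csemiring C by fact
      have kh: "k \<in> csemiring_hom Q C" using k by (simp add: alg_hom_def)
      note [simp] = csemiring_homD[OF c] csemiring_homD(1)[OF kh]
      have "c ?e \<otimes>\<^bsub>C\<^esub> k (g (poly_var A j)) =
          c e \<otimes>\<^bsub>C\<^esub> (c (a [^]\<^bsub>A\<^esub> l') \<otimes>\<^bsub>C\<^esub> (c (a [^]\<^bsub>A\<^esub> l) \<otimes>\<^bsub>C\<^esub> k (g (poly_var A j))))"
        using a e gj by (simp add: C.m_ac)
      also have "\<dots> = c (e \<otimes>\<^bsub>A\<^esub> (a [^]\<^bsub>A\<^esub> l' \<otimes>\<^bsub>A\<^esub> z))"
        unfolding gz[OF C c k v] using a e z by simp
      also have "\<dots> = c e \<otimes>\<^bsub>C\<^esub> (c (a [^]\<^bsub>A\<^esub> l) \<otimes>\<^bsub>C\<^esub> (c (a [^]\<^bsub>A\<^esub> l') \<otimes>\<^bsub>C\<^esub> k (h (poly_var A j))))"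
        unfolding hz[OF C c k v] ez using a e z' by simp
      also have "\<dots> = c ?e \<otimes>\<^bsub>C\<^esub> k (h (poly_var A j))"
        using a e hj by (simp add: C.m_ac)
      finally show ?thesis .
    qed
    then have "W j ?e" unfolding W_def by blast
    moreover have "?e \<in> carrier A - p"
      using a e mem_p[OF e(1)] prime_pow[OF A p] by (simp add: prime_mult_iff[OF A p])
    ultimately show "\<exists>e\<in>carrier A - p. W j e" by blast
  next
    fix j e x assume j: "j < r" and W: "W j e" and e: "e \<in> carrier A" and x: "x \<in> carrier A"
    have gj: "g (poly_var A j) \<in> carrier Q" and hj: "h (poly_var A j) \<in> carrier Q"
      using csemiring_homD(1)[OF gR] csemiring_homD(1)[OF hR] R.var_closed[OF j] by auto
    have "c (e \<otimes>\<^bsub>A\<^esub> x) \<otimes>\<^bsub>C\<^esub> k (g (poly_var A j)) = c (e \<otimes>\<^bsub>A\<^esub> x) \<otimes>\<^bsub>C\<^esub> k (h (poly_var A j))"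
      if C: "csemiring C" and c: "c \<in> csemiring_hom A C" and k: "k \<in> alg_hom A Q (poly_const A) C c"
        and v: "\<forall>i<d. c a \<otimes>\<^bsub>C\<^esub> k (poly_var A i) = c (n i)"
      for C :: "'u ring" and c k
    proof -
      interpret C: csemiring C by fact
      have kh: "k \<in> csemiring_hom Q C" using k by (simp add: alg_hom_def)
      note [simp] = csemiring_homD[OF c] csemiring_homD(1)[OF kh]
      have "c x \<otimes>\<^bsub>C\<^esub> (c e \<otimes>\<^bsub>C\<^esub> k (g (poly_var A j))) = c x \<otimes>\<^bsub>C\<^esub> (c e \<otimes>\<^bsub>C\<^esub> k (h (poly_var A j)))"
        using W C c k v unfolding W_def by simp
      then show ?thesis
        using e x gj hj by (simp add: C.m_ac)
    qed
    then show "W j (e \<otimes>\<^bsub>A\<^esub> x)" unfolding W_def by blast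
  qed
  then obtain e where e: "e \<in> carrier A" "e \<notin> p" and We: "\<And>j. j < r \<Longrightarrow> W j e"
    by blast
  have "alg_hom A B f C c \<noteq> {}"
    if C: "csemiring C" and c: "c \<in> csemiring_hom A C"
      and v: "v \<in> carrier C" "c (a \<otimes>\<^bsub>A\<^esub> e) \<otimes>\<^bsub>C\<^esub> v = \<one>\<^bsub>C\<^esub>" for C :: "'u ring" and c v
  proof -
    interpret C: csemiring C by fact
    note [simp] = csemiring_homD[OF c]
    \<comment> \<open>The inverse of \<open>c a\<close>.\<close>
    define w where "w = c e \<otimes>\<^bsub>C\<^esub> v"
    have w: "w \<in> carrier C" "c a \<otimes>\<^bsub>C\<^esub> w = \<one>\<^bsub>C\<^esub>"
      using v a e by (auto simp: w_def C.m_assoc)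
    have ce: "(c a \<otimes>\<^bsub>C\<^esub> v) \<otimes>\<^bsub>C\<^esub> c e = \<one>\<^bsub>C\<^esub>"
      using v a e by (simp add: C.m_ac)
    obtain k where k: "k \<in> alg_hom A Q (poly_const A) C c"
      and kv: "\<forall>i<d. k (poly_var A i) = c (n i) \<otimes>\<^bsub>C\<^esub> w"
      using Q.ex_poly_eval[OF C c, of "\<lambda>i. c (n i) \<otimes>\<^bsub>C\<^esub> w"] n w by auto
    have "c a \<otimes>\<^bsub>C\<^esub> (c (n i) \<otimes>\<^bsub>C\<^esub> w) = c (n i)" if "i < d" for i
      using n[OF that] a w C.m_lcomm[of "c a" "c (n i)" w] by simp
    with kv have ak: "\<forall>i<d. c a \<otimes>\<^bsub>C\<^esub> k (poly_var A i) = c (n i)"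
      by simp
    have kQ: "k \<in> csemiring_hom Q C" using k by (simp add: alg_hom_def)
    have "k (g x) = k (h x)" if "x \<in> carrier R" for x
    proof (rule R.poly_hom_eqI[OF csemiring_hom_comp[OF gR kQ] csemiring_hom_comp[OF hR kQ] _ _ that])
      fix x assume "x \<in> carrier A"
      then show "k (g (poly_const A x)) = k (h (poly_const A x))"
        using g h by (simp add: alg_hom_def)
    next
      fix j assume j: "j < r"
      have "k (g (poly_var A j)) \<in> carrier C" "k (h (poly_var A j)) \<in> carrier C"
        using csemiring_homD(1)[OF kQ] csemiring_homD(1)[OF gR] csemiring_homD(1)[OF hR]
          R.var_closed[OF j] by auto
      moreover have "(c a \<otimes>\<^bsub>C\<^esub> v) \<otimes>\<^bsub>C\<^esub> (c e \<otimes>\<^bsub>C\<^esub> k (g (poly_var A j))) =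
          (c a \<otimes>\<^bsub>C\<^esub> v) \<otimes>\<^bsub>C\<^esub> (c e \<otimes>\<^bsub>C\<^esub> k (h (poly_var A j)))"
        using We[OF j] C c k ak unfolding W_def by simp
      ultimately show "k (g (poly_var A j)) = k (h (poly_var A j))"
        using ce a e v C.m_assoc[of "c a \<otimes>\<^bsub>C\<^esub> v" "c e"] by simp
    qed
    then show ?thesis
      using coeq C c k unfolding alg_coequaliser_def Q_def R_def by blast
  qed
  moreover have "a \<otimes>\<^bsub>A\<^esub> e \<notin> p"
    using a e by (simp add: prime_mult_iff[OF A p])
  ultimately show ?thesis
    using a(1) e(1) mem_p[of "a \<otimes>\<^bsub>A\<^esub> e"] by (intro bexI[of _ "a \<otimes>\<^bsub>A\<^esub> e"]) auto
qed

text \<open>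
  For \<open>e\<close> as in the previous lemma, the whole neighbourhood \<open>basic_open A e\<close> lies in the image: the
  localisation of \<open>A\<close> at a prime \<open>p\<close> in it inverts \<open>e\<close>, so it receives a map from \<open>B\<close>, along which its
  prime over \<open>p\<close> pulls back to \<open>B\<close>.
\<close>

lemma flat_fp_epi_open_image:
  fixes A B :: "('u::infinite) ring"
  assumes A: "csemiring A" and B: "csemiring B" and flat: "flat_hom A B f"
    and epi: "csemiring_epi A B f" and fp: "finitely_presented_hom A B f"
  shows "openin (Spec A) (Spec_map A f ` topspace (Spec B))"
proof -
  have f: "f \<in> csemiring_hom A B" using flat by (simp add: flat_hom_def)
  note tops = topspace_Spec[OF B]
  have "\<exists>e\<in>carrier A. Spec_map A f q \<in> basic_open A e \<and>
      basic_open A e \<subseteq> Spec_map A f ` topspace (Spec B)"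
    if q: "csemiring_prime B q" for q
  proof -
    obtain e where e: "e \<in> carrier A" "f e \<notin> q"
      and lift: "\<And>(C :: 'u ring) c v. \<lbrakk>csemiring C; c \<in> csemiring_hom A C; v \<in> carrier C;
        c e \<otimes>\<^bsub>C\<^esub> v = \<one>\<^bsub>C\<^esub>\<rbrakk> \<Longrightarrow> alg_hom A B f C c \<noteq> {}"
      using flat_fp_epi_local_section[OF A B flat epi fp q] by blast
    have "p \<in> Spec_map A f ` topspace (Spec B)" if "p \<in> basic_open A e" for p
    proof -
      have p: "csemiring_prime A p" "e \<notin> p"
        using that by (auto simp: basic_open_def)
      obtain C :: "'u ring" and c m where C: "csemiring C" "c \<in> csemiring_hom A C"
        "csemiring_prime C m" "Spec_map A c m = p"
        "\<forall>s\<in>carrier A - p. \<exists>v\<in>carrier C. c s \<otimes>\<^bsub>C\<^esub> v = \<one>\<^bsub>C\<^esub>"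
        using ex_localisation[OF A p(1)] by blast
      obtain v where v: "v \<in> carrier C" "c e \<otimes>\<^bsub>C\<^esub> v = \<one>\<^bsub>C\<^esub>"
        using C(5) e(1) p(2) by blast
      have "alg_hom A B f C c \<noteq> {}"
        by (rule lift[OF C(1,2) v])
      then obtain \<rho> where \<rho>: "\<rho> \<in> csemiring_hom B C" "\<And>x. x \<in> carrier A \<Longrightarrow> \<rho> (f x) = c x"
        by (auto simp: alg_hom_def)
      have "csemiring_prime B (Spec_map B \<rho> m)"
        by (rule Spec_map_prime[OF B \<rho>(1) C(3)])
      moreover have "Spec_map A f (Spec_map B \<rho> m) = p"
        using \<rho>(2) csemiring_homD(1)[OF f] by (auto simp: Spec_map_def C(4)[symmetric])
      ultimately show ?thesis
        by (auto simp: tops)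
    qed
    then show ?thesis
      using e Spec_map_prime[OF A f q] by (auto simp: basic_open_def Spec_map_def)
  qed
  then show ?thesis
    unfolding openin_Spec_iff[OF A] using Spec_map_prime[OF A f] by (auto simp: tops)
qed

theorem theorem1p3p10:
  fixes A B :: "('u::infinite) ring" and f :: "'u \<Rightarrow> 'u"
  assumes "csemiring A" and "csemiring B"
    and "f \<in> csemiring_hom A B"
    and "flat_hom A B f"
    and "finitely_presented_hom A B f"
    and "csemiring_epi A B f"
  shows "\<exists>U. openin (Spec A) U \<and> compactin (Spec A) U \<and>
           homeomorphic_map (Spec B) (subtopology (Spec A) U) (Spec_map A f)"
proof (intro exI conjI)
  let ?U = "Spec_map A f ` topspace (Spec B)"
  show "openin (Spec A) ?U"
    using assms by (intro flat_fp_epi_open_image)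
  show "compactin (Spec A) ?U"
    using compact_space_Spec[OF assms(2)] continuous_map_Spec_map[OF assms(1-3)]
    unfolding compact_space_def by (rule image_compactin)
  show "homeomorphic_map (Spec B) (subtopology (Spec A) ?U) (Spec_map A f)"
    using assms by (intro flat_epi_Spec_embedding)
qed

end
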